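(* Let $\mathbb{K}$ be an algebraically closed field of characteristic $0$, let $n\ge 2$, and let $f\in\mathbb{K}[x_0,\dots,x_n]$ be a nonzero homogeneous cubic polynomial such that the hypersurface $V(f)\subset\mathbb{P}^n$ is smooth. Then the Hessian hypersurface $\mathcal{H}_f=V(h_f)\subset\mathbb{P}^n$ is reduced, and its singular locus is $$\operatorname{Sing}(\mathcal{H}_f)=\mathcal{D}_{n-1}(f).$$
   Context: For a cubic form $f\in\mathbb{K}[x_0,\dots,x_n]$, $H_f=\left(\frac{\partial^2 f}{\partial x_i\partial x_j}\right)_{0\le i,j\le n}$ is its Hessian matrix (a symmetric matrix of linear forms), $h_f=\det(H_f)$ is its Hessian polynomial (of degree $n+1$ if nonzero; it is nonzero when $V(f)$ is smooth), and $\mathcal{H}_f=V(h_f)\subset\mathbb{P}^n$ is the hypersurface (scheme) defined by $h_f$. For an integer $k$, $\mathcal{D}_k(f)=\{[x]\in\mathbb{P}^n \mid \operatorname{Rank}(H_f(x))\le k\}$. *)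

theory Defs
  imports "HOL-Analysis.Analysis" "HOL-Library.Poly_Mapping"
begin

text \<open>
  Polynomials over \<open>'a\<close> in variables indexed by a finite type \<open>'n\<close>, as finitely supported maps
  from exponent vectors to coefficients. With \<open>CARD('n) = n + 1\<close> these are the polynomials in
  \<open>x\<^sub>0, \<dots>, x\<^sub>n\<close>. Multiplication of \<open>\<Rightarrow>\<^sub>0\<close> is convolution, so this is the usual polynomial ring.
\<close>

type_synonym ('n, 'a) mpoly = "('n \<Rightarrow>\<^sub>0 nat) \<Rightarrow>\<^sub>0 'a"

definition Var :: "'n \<Rightarrow> ('n, 'a::comm_ring_1) mpoly" where
  "Var i = Poly_Mapping.single (Poly_Mapping.single i 1) 1"

definition mdegree :: "('n::finite \<Rightarrow>\<^sub>0 nat) \<Rightarrow> nat" where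
  "mdegree m = (\<Sum>i\<in>UNIV. Poly_Mapping.lookup m i)"

definition homogeneous :: "nat \<Rightarrow> ('n::finite, 'a::comm_ring_1) mpoly \<Rightarrow> bool" where
  "homogeneous d p \<longleftrightarrow> (\<forall>m\<in>Poly_Mapping.keys p. mdegree m = d)"

definition eval :: "('n::finite, 'a::comm_ring_1) mpoly \<Rightarrow> 'a ^ 'n \<Rightarrow> 'a" where
  "eval p x = (\<Sum>m\<in>Poly_Mapping.keys p.
     Poly_Mapping.lookup p m * (\<Prod>i\<in>UNIV. (x $ i) ^ Poly_Mapping.lookup m i))"

text \<open>The exponent subtraction below truncates only when the coefficient is \<open>0\<close>.\<close>

definition partial :: "'n \<Rightarrow> ('n, 'a::comm_ring_1) mpoly \<Rightarrow> ('n, 'a) mpoly" where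
  "partial i p = (\<Sum>m\<in>Poly_Mapping.keys p.
     Poly_Mapping.single (m - Poly_Mapping.single i 1)
       (of_nat (Poly_Mapping.lookup m i) * Poly_Mapping.lookup p m))"

definition hessian_matrix :: "('n::finite, 'a::comm_ring_1) mpoly \<Rightarrow> ('n, 'a) mpoly ^ 'n ^ 'n" where
  "hessian_matrix f = (\<chi> i j. partial i (partial j f))"

definition hessian_poly :: "('n::finite, 'a::comm_ring_1) mpoly \<Rightarrow> ('n, 'a) mpoly" where
  "hessian_poly f = det (hessian_matrix f)"

definition hessian_at :: "('n::finite, 'a::comm_ring_1) mpoly \<Rightarrow> 'a ^ 'n \<Rightarrow> 'a ^ 'n ^ 'n" where
  "hessian_at f x = (\<chi> i j. eval (hessian_matrix f $ i $ j) x)"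

text \<open>
  A point \<open>[x]\<close> of projective space is the class of the nonzero vector \<open>x\<close> modulo nonzero scalars.
\<close>

definition proj_point :: "'a::field ^ 'n \<Rightarrow> ('a ^ 'n) set" where
  "proj_point x = {c *s x | c. c \<noteq> 0}"

text \<open>
  Singular points of the hypersurface \<open>V(h)\<close>, for \<open>h\<close> homogeneous: the points of \<open>V(h)\<close> at which
  all first partial derivatives of \<open>h\<close> vanish.
\<close>

definition sing_locus :: "('n::finite, 'a::field) mpoly \<Rightarrow> ('a ^ 'n) set set" where
  "sing_locus h = {proj_point x | x. x \<noteq> 0 \<and> eval h x = 0 \<and> (\<forall>i. eval (partial i h) x = 0)}"

definition smooth_hypersurface :: "('n::finite, 'a::field) mpoly \<Rightarrow> bool" where
  "smooth_hypersurface h \<longleftrightarrow> sing_locus h = {}"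

definition degeneracy_locus :: "nat \<Rightarrow> ('n::finite, 'a::field) mpoly \<Rightarrow> ('a ^ 'n) set set" where
  "degeneracy_locus k f = {proj_point x | x. x \<noteq> 0 \<and> rank (hessian_at f x) \<le> k}"

text \<open>
  The scheme \<open>V(h) = Proj (S/(h))\<close>, with \<open>S\<close> the polynomial ring and \<open>h\<close> homogeneous, is reduced iff
  its coordinate rings on the standard affine charts \<open>x\<^sub>i \<noteq> 0\<close> have no nonzero nilpotents. The ring
  of the \<open>i\<close>-th chart is the degree-zero part of the localization of \<open>S/(h)\<close> at \<open>x\<^sub>i\<close>: its elements
  are the fractions \<open>g / x\<^sub>i\<^sup>d\<close> with \<open>g\<close> homogeneous of degree \<open>d\<close>, and \<open>g / x\<^sub>i\<^sup>d\<close> is zero iff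
  \<open>x\<^sub>i\<^sup>N g \<in> (h)\<close> for some \<open>N\<close>.
\<close>

definition chart_zero ::
    "('n::finite, 'a::comm_ring_1) mpoly \<Rightarrow> 'n \<Rightarrow> ('n, 'a) mpoly \<Rightarrow> bool" where
  "chart_zero h i g \<longleftrightarrow> (\<exists>N. h dvd Var i ^ N * g)"

definition reduced_hypersurface :: "('n::finite, 'a::comm_ring_1) mpoly \<Rightarrow> bool" where
  "reduced_hypersurface h \<longleftrightarrow>
     (\<forall>i d g m. homogeneous d g \<and> chart_zero h i (g ^ m) \<longrightarrow> chart_zero h i g)"

end

theory Submission
  imports Defs "HOL-Computational_Algebra.Polynomial_Factorial"
    "HOL-Computational_Algebra.Squarefree" "HOL-Computational_Algebra.Field_as_Ring"
begin

text \<open>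
  Let \<open>B v\<close> be the Hessian matrix of the cubic at \<open>v\<close>. It is linear in \<open>v\<close>, and smoothness
  says that the quadrics \<open>y\<^sup>T (B v) y\<close> have no common zero \<open>y \<noteq> 0\<close>. If \<open>B x\<close> has corank \<open>1\<close>
  with kernel spanned by \<open>y\<close>, the derivative of \<open>det B\<close> at \<open>x\<close> in direction \<open>v\<close> is a nonzero
  multiple of \<open>y\<^sup>T (B v) y\<close>, hence nonzero for some \<open>v\<close>; if the corank is at least \<open>2\<close>, all
  these derivatives vanish. This gives the singular locus.

  For reducedness, consider \<open>H(t) = h(x + t p)\<close> with \<open>h(p) \<noteq> 0\<close> over the fraction field of the
  ring of polynomial functions of \<open>x\<close>. If \<open>H\<close> had a multiple factor, specialising a Bezout
  identity would give a point \<open>z\<close> at which the tangent cone of \<open>h\<close> is a power \<open>l\<^sup>m\<close>, \<open>m \<ge> 2\<close>, of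
  a linear form. This tangent cone is \<open>v \<mapsto> det (B v restricted to ker (B z))\<close>, so all quadrics
  \<open>B v\<close> with \<open>l v = 0\<close> are singular on \<open>ker (B z)\<close>. A member of maximal rank among them has a
  kernel vector \<open>y\<close> isotropic for all \<open>B v\<close> with \<open>l v = 0\<close> and also for one \<open>B p\<close> with
  \<open>l p \<noteq> 0\<close>, which contradicts smoothness. So \<open>H\<close> is squarefree; as its leading coefficient in
  \<open>t\<close> is a unit, divisibility over the fraction field descends to the polynomial ring.
\<close>

section \<open>Pencils of symmetric matrices\<close>

lemma poly_det:
  fixes M :: "'a::comm_ring_1 poly^'n^'n"
  shows "poly (det M) c = det (\<chi> i j. poly (M $ i $ j) c)"
  unfolding det_def by (simp add: poly_sum poly_mult poly_prod)

definition pencil :: "'a::comm_ring_1^'n^'n \<Rightarrow> 'a^'n^'n \<Rightarrow> 'a \<Rightarrow> 'a^'n^'n" where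
  "pencil A B c = (\<chi> i j. A $ i $ j + c * B $ i $ j)"

text \<open>The determinant stays a polynomial in the parameter because its order of vanishing at 0
  is the quantity measured throughout.\<close>

definition det_pencil :: "'a::comm_ring_1^'n^'n \<Rightarrow> 'a^'n^'n \<Rightarrow> 'a poly" where
  "det_pencil A B = det (\<chi> i j. [:A $ i $ j, B $ i $ j:])"

lemma poly_det_pencil: "poly (det_pencil A B) c = det (pencil A B c)"
  by (simp add: det_pencil_def pencil_def poly_det)

lemma pencil_0 [simp]: "pencil A B 0 = A"
  by (simp add: pencil_def)

lemma pencil_mult_vec: "pencil A B c *v y = A *v y + c *s (B *v y)"
  by (simp add: pencil_def matrix_vector_mult_def vec_eq_iff sum.distrib sum_distrib_left
      distrib_right mult.assoc)

definition qform :: "'a::comm_ring_1^'n^'n \<Rightarrow> 'a^'n \<Rightarrow> 'a" where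
  "qform A y = (\<Sum>i\<in>UNIV. y $ i * (A *v y) $ i)"

definition congruent_by :: "'a::comm_ring_1^'n^'n \<Rightarrow> 'a^'n^'n \<Rightarrow> 'a^'n^'n" where
  "congruent_by P A = transpose P ** A ** P"

lemma dot_transpose:
  fixes A :: "'a::comm_ring_1^'n^'m"
  shows "(\<Sum>i\<in>UNIV. u $ i * (A *v v) $ i) = (\<Sum>j\<in>UNIV. (transpose A *v u) $ j * v $ j)"
proof -
  have "(\<Sum>i\<in>UNIV. u $ i * (A *v v) $ i) = (\<Sum>i\<in>UNIV. \<Sum>j\<in>UNIV. u $ i * (A $ i $ j * v $ j))"
    by (simp add: matrix_vector_mult_def sum_distrib_left)
  also have "\<dots> = (\<Sum>j\<in>UNIV. \<Sum>i\<in>UNIV. u $ i * (A $ i $ j * v $ j))"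
    by (rule sum.swap)
  also have "\<dots> = (\<Sum>j\<in>UNIV. (transpose A *v u) $ j * v $ j)"
    by (simp add: matrix_vector_mult_def transpose_def sum_distrib_right sum_distrib_left mult_ac)
  finally show ?thesis .
qed

lemma qform_congruent_by: "qform (congruent_by P A) u = qform A (P *v u)"
proof -
  have "qform (congruent_by P A) u = (\<Sum>i\<in>UNIV. u $ i * (transpose P *v (A *v (P *v u))) $ i)"
    by (simp add: qform_def congruent_by_def matrix_vector_mul_assoc matrix_mul_assoc)
  also have "\<dots> = qform A (P *v u)"
    by (subst dot_transpose) (simp add: qform_def)
  finally show ?thesis .
qed

lemma transpose_congruent_by: "transpose (congruent_by P A) = congruent_by P (transpose A)"
  by (simp add: congruent_by_def matrix_transpose_mul matrix_mul_assoc)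

lemma pencil_matrix_mul_left: "M ** pencil A B c = pencil (M ** A) (M ** B) c"
  by (simp add: pencil_def matrix_matrix_mult_def vec_eq_iff sum.distrib sum_distrib_left
      algebra_simps)

lemma pencil_matrix_mul_right: "pencil A B c ** M = pencil (A ** M) (B ** M) c"
  by (simp add: pencil_def matrix_matrix_mult_def vec_eq_iff sum.distrib sum_distrib_left
      algebra_simps)

lemma congruent_by_pencil:
  "congruent_by P (pencil A B c) = pencil (congruent_by P A) (congruent_by P B) c"
  by (simp add: congruent_by_def pencil_matrix_mul_left pencil_matrix_mul_right)

lemma det_congruent_by: "det (congruent_by P A) = det P ^ 2 * det A"
  by (simp add: congruent_by_def det_mul power2_eq_square mult_ac)

text \<open>The point 0 is left out so that identities involving \<open>inverse c\<close> can be
  tested; infinitely many points remain.\<close>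

lemma poly_eqI_infinite:
  fixes p q :: "'a::{idom,ring_char_0} poly"
  assumes "\<And>c. c \<noteq> 0 \<Longrightarrow> poly p c = poly q c"
  shows "p = q"
proof (rule ccontr)
  assume "p \<noteq> q"
  then have "finite {c. poly (p - q) c = 0}"
    by (intro poly_roots_finite) simp
  moreover have "UNIV - {0} \<subseteq> {c. poly (p - q) c = 0}"
    using assms by auto
  ultimately have "finite (UNIV - {0::'a})"
    using finite_subset by blast
  then show False
    using infinite_UNIV_char_0 by (metis finite_Diff2 finite.emptyI finite.insertI)
qed

lemma det_pencil_congruent_by:
  fixes A :: "'a::{idom,ring_char_0}^'n^'n"
  shows "det_pencil (congruent_by P A) (congruent_by P B) = [:det P ^ 2:] * det_pencil A B"
  by (rule poly_eqI_infinite)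
    (simp add: poly_det_pencil flip: congruent_by_pencil, simp add: det_congruent_by)

section \<open>Kernels, coordinates adapted to them, and the lowest-order term of a
  determinant\<close>

lemma det_eq_0_iff_kernel:
  fixes A :: "'a::field^'n^'n"
  shows "det A = 0 \<longleftrightarrow> (\<exists>y. y \<noteq> 0 \<and> A *v y = 0)"
  using invertible_det_nz[of A] matrix_left_invertible_ker[of A] invertible_left_inverse[of A]
  by blast

text \<open>A basis of the kernel containing \<open>y\<close> is extended to the whole space; the
  columns of \<open>P\<close> are this basis, and \<open>I\<close> indexes the part that spans the
  kernel.\<close>

lemma adapted_basis:
  fixes A :: "'a::field^'n^'n"
  assumes "A *v y = 0" "y \<noteq> 0"
  obtains P :: "'a^'n^'n" and i0 I where "invertible P" "i0 \<in> I" "P *v axis i0 1 = y"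
    "\<And>u. A *v (P *v u) = 0 \<longleftrightarrow> (\<forall>i. i \<notin> I \<longrightarrow> u $ i = 0)"
    "card I = vec.dim {u. A *v u = 0}"
proof -
  define V where "V = {u. A *v u = 0}"
  have subV: "vec.subspace V"
    unfolding vec.subspace_def V_def
    by (auto simp: matrix_vector_right_distrib vec.scale)
  have yV: "{y} \<subseteq> V" using assms by (simp add: V_def)
  have "vec.independent {y}" using assms(2) by simp
  then obtain B1 where B1: "{y} \<subseteq> B1" "B1 \<subseteq> V" "vec.independent B1" "V \<subseteq> vec.span B1"
    using vec.maximal_independent_subset_extend[OF yV] by blast
  obtain B2 where B2: "B1 \<subseteq> B2" "B2 \<subseteq> UNIV" "vec.independent B2" "UNIV \<subseteq> vec.span B2"
    by (rule vec.maximal_independent_subset_extend[OF subset_UNIV B1(3)])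
  have finB2: "finite B2" using B2(3) by (rule vec.finiteI_independent)
  have "card B2 = vec.dim (UNIV::('a^'n) set)"
    by (rule vec.basis_card_eq_dim[OF B2(2,4,3)])
  then have "card B2 = CARD('n)" by (simp only: vec_dim_card)
  then obtain b :: "'n \<Rightarrow> 'a^'n" where b: "bij_betw b UNIV B2"
    using finB2 by (metis finite_class.finite_UNIV finite_same_card_bij)
  define P :: "'a^'n^'n" where "P = (\<chi> i j. b j $ i)"
  define I where "I = {i. b i \<in> B1}"
  have colP: "column j P = b j" for j
    by (simp add: column_def P_def vec_eq_iff)
  have Pax: "P *v axis j 1 = b j" for j
    by (simp add: P_def vec_eq_iff matrix_vector_mult_def axis_def if_distrib cong: if_cong)
  have "columns P = B2"
    using b by (auto simp: columns_def colP bij_betw_def)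
  then have "\<exists>Q. P ** Q = mat 1"
    using B2(4) by (subst matrix_right_invertible_span_columns) auto
  then have invP: "invertible P"
    by (simp add: invertible_right_inverse)
  then have injP: "P *v u = P *v u' \<Longrightarrow> u = u'" for u u'
    by (metis invertible_left_inverse matrix_vector_mul_assoc matrix_vector_mul_lid)
  define S where "S = {u::'a^'n. \<forall>i. i \<notin> I \<longrightarrow> u $ i = 0}"
  have subS: "vec.subspace S"
    unfolding vec.subspace_def S_def by auto
  have subPS: "vec.subspace ((*v) P ` S)"
    by (rule vec.subspace_image[OF subS])
  have B1P: "B1 \<subseteq> (*v) P ` S"
  proof
    fix v assume v: "v \<in> B1"
    then obtain i where i: "b i = v" using b B2(1) by (metis bij_betw_imp_surj_on imageE subsetD)
    then have "axis i 1 \<in> S" using v by (auto simp: S_def I_def axis_def)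
    then show "v \<in> (*v) P ` S" using Pax i by (metis imageI)
  qed
  have VPS: "V \<subseteq> (*v) P ` S"
    using B1(4) vec.span_minimal[OF B1P subPS] by blast
  have PSV: "P *v u \<in> V" if "u \<in> S" for u
  proof -
    have "P *v u = (\<Sum>j\<in>UNIV. u $ j *s b j)"
      by (simp add: matrix_mult_sum colP)
    also have "\<dots> \<in> V"
    proof (rule vec.subspace_sum[OF subV])
      fix j
      show "u $ j *s b j \<in> V"
      proof (cases "j \<in> I")
        case True
        then show ?thesis using B1(2) vec.subspace_scale[OF subV] by (auto simp: I_def)
      next
        case False
        then show ?thesis using that vec.subspace_0[OF subV] by (simp add: S_def)
      qed
    qed
    finally show ?thesis .
  qed
  have ker: "A *v (P *v u) = 0 \<longleftrightarrow> (\<forall>i. i \<notin> I \<longrightarrow> u $ i = 0)" for u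
  proof -
    have "A *v (P *v u) = 0 \<longleftrightarrow> P *v u \<in> V" by (simp add: V_def)
    also have "\<dots> \<longleftrightarrow> u \<in> S" using PSV VPS injP by blast
    finally show ?thesis by (simp add: S_def)
  qed
  have "bij_betw b I B1"
    using b B2(1) by (auto simp: bij_betw_def I_def inj_on_def image_iff)
  then have "card I = card B1" by (rule bij_betw_same_card)
  also have "\<dots> = vec.dim V" using vec.basis_card_eq_dim[OF B1(2,4,3)] .
  finally have cI: "card I = vec.dim {u. A *v u = 0}" by (simp add: V_def)
  obtain i0 where i0: "b i0 = y" using b B2(1) B1(1) by (metis bij_betw_imp_surj_on imageE insert_subset subsetD)
  then have i0I: "i0 \<in> I" using B1(1) by (simp add: I_def)
  show thesis
    by (rule that[OF invP i0I Pax[of i0, unfolded i0] ker cI])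
qed

definition coord_kernel :: "'a::field^'n^'n \<Rightarrow> 'n set \<Rightarrow> bool" where
  "coord_kernel A I \<longleftrightarrow> (\<forall>u. A *v u = 0 \<longleftrightarrow> (\<forall>i. i \<notin> I \<longrightarrow> u $ i = 0))"

lemma invertible_mult_vec_eq_0:
  fixes P :: "'a::field^'n^'n"
  assumes "invertible P"
  shows "P *v u = 0 \<longleftrightarrow> u = 0"
  using assms by (metis invertible_left_inverse matrix_vector_mul_assoc matrix_vector_mul_lid matrix_vector_mult_0_right)

lemma congruent_by_mult_vec: "congruent_by P A *v u = transpose P *v (A *v (P *v u))"
  by (simp add: congruent_by_def matrix_vector_mul_assoc matrix_mul_assoc)

text \<open>Congruence by an invertible \<open>P\<close> preserves symmetry and changes determinants
  of pencils by a nonzero constant, so questions about a singular \<open>A\<close> can be moved to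
  coordinates in which axis vectors span its kernel.\<close>

lemma adapted_congruence:
  fixes A :: "'a::field^'n^'n"
  assumes "A *v y = 0" "y \<noteq> 0"
  obtains P :: "'a^'n^'n" and i0 I where "invertible P" "i0 \<in> I" "P *v axis i0 1 = y"
    "coord_kernel (congruent_by P A) I" "card I = vec.dim {u. A *v u = 0}"
proof -
  obtain P :: "'a^'n^'n" and i0 I where P: "invertible P" "i0 \<in> I" "P *v axis i0 1 = y"
    "\<And>u. A *v (P *v u) = 0 \<longleftrightarrow> (\<forall>i. i \<notin> I \<longrightarrow> u $ i = 0)"
    "card I = vec.dim {u. A *v u = 0}"
    by (rule adapted_basis[OF assms]) blast
  have "congruent_by P A *v u = 0 \<longleftrightarrow> A *v (P *v u) = 0" for u
    using P(1) invertible_mult_vec_eq_0[of "transpose P"]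
    by (simp add: congruent_by_mult_vec invertible_det_nz del: vector_transpose_matrix transpose_matrix_vector)
  then have "coord_kernel (congruent_by P A) I"
    using P(4) by (simp add: coord_kernel_def)
  then show thesis by (rule that[OF P(1-3) _ P(5)])
qed

text \<open>
  \<open>cut I B\<close> is invertible iff the \<open>I \<times> I\<close> block of \<open>B\<close> is: padding with an identity block
  avoids matrices over a varying index type.
\<close>

definition cut :: "'n set \<Rightarrow> 'a::comm_ring_1^'n^'n \<Rightarrow> 'a^'n^'n" where
  "cut I B = (\<chi> i j. if i \<in> I \<and> j \<in> I then B $ i $ j else if i = j then 1 else 0)"

text \<open>The padding is zero, unlike that of \<open>cut\<close>, so that the identity part of
  \<open>cut I A\<close> does not move along a pencil.\<close>

definition block :: "'n set \<Rightarrow> 'a::comm_ring_1^'n^'n \<Rightarrow> 'a^'n^'n" where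
  "block I B = (\<chi> i j. if i \<in> I \<and> j \<in> I then B $ i $ j else 0)"

lemma cut_pencil: "cut I (pencil A B c) = pencil (cut I A) (block I B) c"
  by (simp add: cut_def block_def pencil_def vec_eq_iff)

lemma cut_mult_vec_eq_0:
  fixes B :: "'a::field^'n^'n"
  shows "cut I B *v u = 0 \<longleftrightarrow> (\<forall>i. if i \<in> I then (B *v u) $ i = 0 else u $ i = 0)"
proof -
  have 1: "(cut I B *v u) $ i = u $ i" if "i \<notin> I" for i
    using that by (simp add: cut_def matrix_vector_mult_def if_distrib[of "\<lambda>x. x * _"] cong: if_cong)
  have 2: "(cut I B *v u) $ i = (B *v u) $ i" if "i \<in> I" "\<forall>i. i \<notin> I \<longrightarrow> u $ i = 0" for i
    using that unfolding cut_def matrix_vector_mult_def by (auto intro!: sum.cong)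
  show ?thesis
    unfolding vec_eq_iff using 1 2 by (metis zero_index)
qed

lemma coord_kernel_symmetric_zero:
  fixes A :: "'a::field^'n^'n"
  assumes "transpose A = A" "coord_kernel A I" "i \<in> I"
  shows "A $ i $ j = 0" "A $ j $ i = 0"
proof -
  have "A *v axis i 1 = 0"
    using assms(2,3) unfolding coord_kernel_def by (auto simp: axis_def)
  then have *: "A $ j $ i = 0" for j
    by (simp add: vec_eq_iff matrix_vector_mult_def axis_def if_distrib cong: if_cong)
  then show "A $ j $ i = 0" .
  have "transpose A $ i $ j = 0" using * by (simp add: transpose_def)
  then show "A $ i $ j = 0" using assms(1) by simp
qed

text \<open>By symmetry the rows of \<open>A\<close> with index in \<open>I\<close> vanish, so each
  of these rows of the pencil has a factor of the variable. Once these factors are taken out,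
  whether the rest vanishes at 0 is decided by \<open>B\<close> on the kernel of
  \<open>A\<close>.\<close>

lemma det_pencil_coord_kernel:
  fixes A :: "'a::field^'n^'n"
  assumes "transpose A = A" "coord_kernel A I"
  obtains r where "det_pencil A B = [:0, 1:] ^ card I * r"
    "poly r 0 = 0 \<longleftrightarrow> det (cut I B) = 0"
proof -
  note A0 = coord_kernel_symmetric_zero[OF assms]
  define c :: "'n \<Rightarrow> 'a poly" where "c i = (if i \<in> I then [:0, 1:] else 1)" for i
  define a :: "'n \<Rightarrow> 'a poly ^'n"
    where "a i = (\<chi> j. if i \<in> I then [:B $ i $ j:] else [:A $ i $ j, B $ i $ j:])" for i
  define r where "r = det (\<chi> i. a i)"
  have "(\<chi> i j. [:A $ i $ j, B $ i $ j:]) = (\<chi> i. c i *s a i)"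
    by (auto simp: vec_eq_iff c_def a_def A0)
  then have "det_pencil A B = prod c UNIV * r"
    unfolding det_pencil_def r_def by (simp only: det_rows_mul)
  also have "prod c UNIV = [:0, 1:] ^ card I"
    by (simp add: c_def prod.If_cases)
  finally have 1: "det_pencil A B = [:0, 1:] ^ card I * r" .
  \<comment> \<open>\<open>r\<close> has the value \<open>det M\<close> at 0. The kernel of
    \<open>M\<close> is that of \<open>cut I B\<close>: the rows of \<open>A\<close> confine
    \<open>u\<close> to the kernel of \<open>A\<close>, and the rows of \<open>B\<close> then test
    it on the \<open>I\<close> block.\<close>
  define M where "M = (\<chi> i j. if i \<in> I then B $ i $ j else A $ i $ j)"
  have M: "poly r 0 = det M"
    unfolding r_def M_def poly_det a_def by (auto intro!: arg_cong[where f=det] simp: vec_eq_iff)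
  have Mi: "(M *v u) $ i = (if i \<in> I then (B *v u) $ i else (A *v u) $ i)" for u i
    by (simp add: M_def matrix_vector_mult_def)
  have Ai: "(A *v u) $ i = 0" if "i \<in> I" for u i
    using that by (simp add: matrix_vector_mult_def A0)
  have "M *v u = 0 \<longleftrightarrow> cut I B *v u = 0" for u
  proof -
    have "M *v u = 0 \<longleftrightarrow> A *v u = 0 \<and> (\<forall>i\<in>I. (B *v u) $ i = 0)"
      unfolding vec_eq_iff Mi using Ai by (auto split: if_splits)
    also have "\<dots> \<longleftrightarrow> cut I B *v u = 0"
      unfolding cut_mult_vec_eq_0 using assms(2) unfolding coord_kernel_def by auto
    finally show ?thesis .
  qed
  then have "det M = 0 \<longleftrightarrow> det (cut I B) = 0"
    by (simp add: det_eq_0_iff_kernel)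
  with M have "poly r 0 = 0 \<longleftrightarrow> det (cut I B) = 0" by simp
  with 1 show thesis by (rule that)
qed

lemma det_cut_singleton:
  fixes B :: "'a::field^'n^'n"
  shows "det (cut {i} B) = 0 \<longleftrightarrow> B $ i $ i = 0"
proof -
  have *: "(B *v u) $ i = B $ i $ i * u $ i" if "\<And>j. j \<noteq> i \<Longrightarrow> u $ j = 0" for u
  proof -
    have "(B *v u) $ i = (\<Sum>j\<in>UNIV. if j = i then B $ i $ j * u $ j else 0)"
      unfolding matrix_vector_mult_def vec_lambda_beta using that by (intro sum.cong) auto
    then show ?thesis by simp
  qed
  show ?thesis
  proof
    assume "det (cut {i} B) = 0"
    then obtain u where u: "u \<noteq> 0" "cut {i} B *v u = 0"
      unfolding det_eq_0_iff_kernel by blast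
    then have 1: "u $ j = 0" if "j \<noteq> i" for j
      using that unfolding cut_mult_vec_eq_0 by auto
    have "B $ i $ i * u $ i = 0"
      using u(2) *[OF 1] unfolding cut_mult_vec_eq_0 by auto
    moreover have "u $ i \<noteq> 0" using 1 u(1) by (metis vec_eq_iff zero_index)
    ultimately show "B $ i $ i = 0" by simp
  next
    assume "B $ i $ i = 0"
    then have "cut {i} B *v axis i 1 = 0"
      unfolding cut_mult_vec_eq_0 using *[of "axis i 1"] by (auto simp: axis_def)
    then show "det (cut {i} B) = 0"
      unfolding det_eq_0_iff_kernel by (metis axis_eq_0_iff zero_neq_one)
  qed
qed

section \<open>Isotropic vectors in the kernels of symmetric matrices\<close>

lemma exists_nonroot:
  fixes p :: "'a::{idom,ring_char_0} poly"
  assumes "p \<noteq> 0"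
  shows "\<exists>c. c \<noteq> 0 \<and> poly p c \<noteq> 0"
  using poly_eqI_infinite[of p 0] assms by auto

lemma qform_axis: "qform A (axis i 1) = A $ i $ i"
  by (simp add: qform_def matrix_vector_mult_def axis_def if_distrib if_distribR cong: if_cong)

text \<open>
  \<open>X0\<close> is a member of maximal rank: a kernel vector \<open>y\<close> with \<open>y\<^sup>T Y y \<noteq> 0\<close> would make the rank of
  \<open>X0 + c Y\<close> larger for some \<open>c\<close>.
\<close>

lemma generic_kernel:
  fixes XX YY :: "('a::field_char_0^'n^'n) set"
  assumes ne: "XX \<noteq> {}"
    and symX: "\<And>X. X \<in> XX \<Longrightarrow> transpose X = X"
    and closed: "\<And>X Y c. X \<in> XX \<Longrightarrow> Y \<in> YY \<Longrightarrow> pencil X Y c \<in> XX"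
  obtains X0 where "X0 \<in> XX" "\<And>y Y. X0 *v y = 0 \<Longrightarrow> Y \<in> YY \<Longrightarrow> qform Y y = 0"
proof -
  define d where "d X = vec.dim {u. X *v u = 0}" for X :: "'a^'n^'n"
  obtain X0 where X0: "X0 \<in> XX" "\<And>X. X \<in> XX \<Longrightarrow> d X0 \<le> d X"
    using ne arg_min_nat_lemma[of "\<lambda>X. X \<in> XX" _ d] by blast
  have "qform Y y = 0" if ker: "X0 *v y = 0" and Y: "Y \<in> YY" for y Y
  proof (rule ccontr)
    assume q: "qform Y y \<noteq> 0"
    then have y0: "y \<noteq> 0" by (auto simp: qform_def)
    obtain P :: "'a^'n^'n" and i0 I where P: "invertible P" "i0 \<in> I" "P *v axis i0 1 = y"
      "coord_kernel (congruent_by P X0) I" "card I = vec.dim {u. X0 *v u = 0}"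
      by (rule adapted_congruence[OF ker y0]) blast
    define X' Y' where "X' = congruent_by P X0" and "Y' = congruent_by P Y"
    have symX': "transpose X' = X'"
      by (simp add: X'_def transpose_congruent_by symX X0(1))
    have kX': "coord_kernel X' I" using P(4) by (simp add: X'_def)
    note X'0 = coord_kernel_symmetric_zero[OF symX' kX']
    \<comment> \<open>Adding \<open>D\<close> shrinks the kernel to the line of
      \<open>axis i0 1\<close>, so that the lowest-order term of the determinant is governed by the
      single entry \<open>Y' $ i0 $ i0\<close>.\<close>
    define D :: "'a^'n^'n" where "D = (\<chi> i j. if i = j \<and> i \<in> I - {i0} then 1 else 0)"
    have Du: "(D *v u) $ i = (if i \<in> I - {i0} then u $ i else 0)" for u i
      by (cases "i \<in> I - {i0}")
        (auto simp: D_def matrix_vector_mult_def if_distrib[of "\<lambda>x. x * _"] cong: if_cong)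
    have X'u: "(X' *v u) $ i = 0" if "i \<in> I" for u i
      using that by (simp add: matrix_vector_mult_def X'0)
    have "coord_kernel (X' + D) {i0}"
      unfolding coord_kernel_def
    proof
      fix u
      have "((X' + D) *v u) $ i = 0 \<longleftrightarrow> (X' *v u) $ i = 0 \<and> (D *v u) $ i = 0" for i
        by (cases "i \<in> I") (simp_all add: matrix_vector_mult_add_rdistrib X'u Du)
      then have "(X' + D) *v u = 0 \<longleftrightarrow> X' *v u = 0 \<and> D *v u = 0"
        unfolding vec_eq_iff zero_index by blast
      also have "\<dots> \<longleftrightarrow> (\<forall>i. i \<notin> {i0} \<longrightarrow> u $ i = 0)"
        using kX' P(2) unfolding coord_kernel_def vec_eq_iff[of "D *v u"] Du by auto
      finally show "(X' + D) *v u = 0 \<longleftrightarrow> (\<forall>i. i \<notin> {i0} \<longrightarrow> u $ i = 0)" .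
    qed
    moreover have "transpose (X' + D) = X' + D"
      using symX' by (auto simp: transpose_def vec_eq_iff D_def)
    ultimately obtain r where r: "det_pencil (X' + D) Y' = [:0, 1:] ^ card {i0} * r"
      "poly r 0 = 0 \<longleftrightarrow> det (cut {i0} Y') = 0"
      using det_pencil_coord_kernel[of "X' + D" "{i0}" Y'] by blast
    have Y'0: "Y' $ i0 $ i0 \<noteq> 0"
      using q by (simp add: Y'_def qform_congruent_by P(3) flip: qform_axis)
    have "det (cut {i0} Y') \<noteq> 0"
      using Y'0 by (simp add: det_cut_singleton)
    then have "det_pencil (X' + D) Y' \<noteq> 0" using r by auto
    then obtain c where c: "poly (det_pencil (X' + D) Y') c \<noteq> 0"
      using exists_nonroot by blast
    define N where "N = pencil (X' + D) Y' c"
    have invN: "invertible N"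
      using c by (simp add: N_def poly_det_pencil invertible_det_nz)
    obtain Q where Q: "P ** Q = mat 1" "Q ** P = mat 1" using P(1) unfolding invertible_def by blast
    have "invertible Q" using Q unfolding invertible_def by blast
    then have invNQ: "invertible (N ** Q)" using invN by (rule invertible_mult[rotated])
    define W where "W = {u. pencil X0 Y c *v u = 0}"
    \<comment> \<open>On the kernel of \<open>pencil X0 Y c\<close> the invertible \<open>N\<close>
      agrees with \<open>D\<close>, up to the change of basis, and the image of \<open>D\<close>
      lies in a space of dimension \<open>card I - 1\<close>. The kernel is thus smaller than the
      minimum \<open>d X0\<close>.\<close>
    have "(N ** Q) *v u \<in> {x. \<forall>i. i \<notin> I - {i0} \<longrightarrow> x $ i = 0}" if "u \<in> W" for u
    proof -
      define v where "v = Q *v u"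
      have "P *v v = u" by (simp add: v_def matrix_vector_mul_assoc Q)
      then have "congruent_by P (pencil X0 Y c) *v v = 0"
        using that by (simp add: congruent_by_mult_vec W_def)
      then have "X' *v v + c *s (Y' *v v) = 0"
        by (simp add: congruent_by_pencil X'_def Y'_def pencil_mult_vec)
      then have "N *v v = D *v v"
        by (simp add: N_def pencil_mult_vec matrix_vector_mult_add_rdistrib algebra_simps)
      then show ?thesis using Du by (auto simp: v_def simp flip: matrix_vector_mul_assoc)
    qed
    then have "vec.dim ((*v) (N ** Q) ` W) \<le> vec.dim {x::'a^'n. \<forall>i. i \<notin> I - {i0} \<longrightarrow> x $ i = 0}"
      by (intro vec.dim_subset) blast
    moreover have "vec.dim ((*v) (N ** Q) ` W) = vec.dim W"
    proof (rule vec.dim_image_eq)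
      show "Vector_Spaces.linear (*s) (*s) ((*v) (N ** Q))" by simp
      show "inj_on ((*v) (N ** Q)) (vec.span W)"
        using invertible_eq_bij[of "N ** Q"] invNQ by (meson bij_is_inj inj_on_subset subset_UNIV)
    qed
    ultimately have "vec.dim W \<le> card (I - {i0})"
      by (simp only: dim_substandard_cart)
    also have "\<dots> < card I" by (rule card_Diff1_less[OF finite P(2)])
    also have "\<dots> = d X0" using P(5) by (simp add: d_def)
    finally have "d (pencil X0 Y c) < d X0" by (simp add: d_def W_def)
    moreover have "pencil X0 Y c \<in> XX" using closed X0(1) \<open>Y \<in> YY\<close> by blast
    ultimately show False using X0(2) by fastforce
  qed
  with X0(1) that show thesis by blast
qed

lemma qform_axis_add:
  fixes B :: "'a::field^'n^'n"
  shows "qform B (axis i 1 + s *s axis j 1) = B $ i $ i + s * (B $ i $ j + B $ j $ i) + s * s * B $ j $ j"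
proof -
  have *: "B *v axis i 1 = (\<chi> k. B $ k $ i)" for i
    by (simp add: vec_eq_iff matrix_vector_mult_def axis_def if_distrib cong: if_cong)
  have **: "(\<Sum>k\<in>UNIV. axis i 1 $ k * f k) = f i" for i and f :: "'n \<Rightarrow> 'a"
    by (simp add: axis_def if_distrib if_distribR cong: if_cong)
  have "qform B (axis i 1 + s *s axis j 1) =
    (\<Sum>k\<in>UNIV. axis i 1 $ k * (B $ k $ i + s * B $ k $ j)) +
    s * (\<Sum>k\<in>UNIV. axis j 1 $ k * (B $ k $ i + s * B $ k $ j))"
    by (simp add: qform_def matrix_vector_right_distrib vec.scale *
        distrib_right sum.distrib sum_distrib_left mult.assoc)
  then show ?thesis unfolding ** by (simp add: algebra_simps)
qed

text \<open>If the kernel is a line, the linear coefficient of the determinant vanishes exactly when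
  \<open>qform B y\<close> does. If the kernel contains a plane, algebraic closedness gives an
  isotropic vector on that plane for any \<open>B\<close>.\<close>

lemma isotropic_kernel_vector:
  fixes A B :: "'a::{alg_closed_field,field_char_0}^'n^'n"
  assumes sym: "transpose A = A" and dvd: "[:0, 1:] ^ 2 dvd det_pencil A B"
  shows "\<exists>y. y \<noteq> 0 \<and> A *v y = 0 \<and> qform B y = 0"
proof -
  have "[:0, 1:] dvd det_pencil A B"
    using dvd by (meson dvd_power dvd_trans pos2)
  then have "det A = 0"
    using poly_det_pencil[of A B 0] by (auto elim!: dvdE)
  then obtain y where y: "A *v y = 0" "y \<noteq> 0" unfolding det_eq_0_iff_kernel by blast
  obtain P :: "'a^'n^'n" and i0 I where P: "invertible P" "i0 \<in> I" "P *v axis i0 1 = y"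
    "coord_kernel (congruent_by P A) I" "card I = vec.dim {u. A *v u = 0}"
    by (rule adapted_congruence[OF y]) blast
  define B' where "B' = congruent_by P B"
  have *: ?thesis if "\<forall>i. i \<notin> I \<longrightarrow> u $ i = 0" "u \<noteq> 0" "qform B' u = 0" for u
  proof (intro exI conjI)
    show "P *v u \<noteq> 0" using P(1) \<open>u \<noteq> 0\<close> by (simp add: invertible_mult_vec_eq_0)
    show "qform B (P *v u) = 0" using \<open>qform B' u = 0\<close> by (simp add: B'_def qform_congruent_by)
    have "congruent_by P A *v u = 0" using that(1) P(4) by (simp add: coord_kernel_def)
    then have "transpose P *v (A *v (P *v u)) = 0" by (simp only: congruent_by_mult_vec)
    moreover have "invertible (transpose P)" using P(1) by (simp add: invertible_det_nz)
    ultimately show "A *v (P *v u) = 0" using invertible_mult_vec_eq_0 by blast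
  qed
  show ?thesis
  proof (cases "I = {i0}")
    case True
    obtain r where r: "det_pencil (congruent_by P A) B' = [:0, 1:] ^ card I * r"
      "poly r 0 = 0 \<longleftrightarrow> det (cut I B') = 0"
      by (rule det_pencil_coord_kernel[OF _ P(4)]) (auto simp: transpose_congruent_by sym)
    have "[:0, 1:] ^ 2 dvd det_pencil (congruent_by P A) B'"
      using dvd unfolding B'_def det_pencil_congruent_by by (rule dvd_mult)
    then have "[:0, 1:] * [:0, 1:] dvd [:0, 1:] * r"
      unfolding r(1) True by (simp only: power2_eq_square card.insert finite.emptyI empty_iff
          not_False_eq_True card.empty One_nat_def[symmetric] power_one_right)
    then have "[:0, 1:] dvd r" by (subst (asm) dvd_mult_cancel_left) simp
    then have "poly r 0 = 0" by (auto elim!: dvdE)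
    then have "B' $ i0 $ i0 = 0" using r(2) True by (simp add: det_cut_singleton)
    moreover have "qform B y = qform B' (axis i0 1)"
      by (simp add: B'_def P(3) qform_congruent_by)
    ultimately have "qform B y = 0" by (simp add: qform_axis)
    with y show ?thesis by blast
  next
    case False
    then obtain i1 where i1: "i1 \<in> I" "i1 \<noteq> i0" using P(2) by blast
    show ?thesis
    proof (cases "B' $ i1 $ i1 = 0")
      case True
      show ?thesis
      proof (rule *)
        show "qform B' (axis i1 1) = 0" using True by (simp add: qform_axis)
        show "axis i1 (1::'a) \<noteq> 0" by (simp add: axis_eq_0_iff)
        show "\<forall>i. i \<notin> I \<longrightarrow> axis i1 1 $ i = 0" using i1 by (auto simp: axis_def)
      qed
    next
      case False
      \<comment> \<open>The polynomial is \<open>qform B'\<close> at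
        \<open>axis i0 1 + s *s axis i1 1\<close>; its leading coefficient is the nonzero entry at
        \<open>i1\<close>.\<close>
      then have "degree [:B' $ i0 $ i0, B' $ i0 $ i1 + B' $ i1 $ i0, B' $ i1 $ i1:] > 0" by simp
      then obtain s where s: "poly [:B' $ i0 $ i0, B' $ i0 $ i1 + B' $ i1 $ i0, B' $ i1 $ i1:] s = 0"
        using alg_closed_imp_poly_has_root by blast
      show ?thesis
      proof (rule *)
        show "qform B' (axis i0 1 + s *s axis i1 1) = 0"
          using s by (simp add: qform_axis_add algebra_simps)
        have "(axis i0 1 + s *s axis i1 1) $ i0 = 1" using i1 by (simp add: axis_def)
        then show "axis i0 1 + s *s axis i1 1 \<noteq> 0" by (metis zero_index zero_neq_one)
        show "\<forall>i. i \<notin> I \<longrightarrow> (axis i0 1 + s *s axis i1 1) $ i = 0"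
          using i1 P(2) by (auto simp: axis_def)
      qed
    qed
  qed
qed

lemma qform_block:
  assumes "\<And>i. i \<notin> I \<Longrightarrow> u $ i = 0"
  shows "qform (block I B) u = qform B u"
proof -
  have "u $ i * (block I B *v u) $ i = u $ i * (B *v u) $ i" for i
  proof (cases "i \<in> I")
    case True
    then have "(block I B *v u) $ i = (B *v u) $ i"
      unfolding block_def matrix_vector_mult_def using assms by (auto intro!: sum.cong)
    then show ?thesis by simp
  qed (simp add: assms)
  then show ?thesis by (simp add: qform_def)
qed

lemma transpose_cut: "transpose B = B \<Longrightarrow> transpose (cut I B) = cut I B"
  by (auto simp: cut_def transpose_def vec_eq_iff)

text \<open>Pulling \<open>c\<close> out of the rows indexed by \<open>I\<close> exchanges the two
  ends of the pencil: on the block, \<open>A + c C\<close> is \<open>c\<close> times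
  \<open>C + inverse c A\<close>.\<close>

lemma det_cut_scale:
  fixes A C :: "'a::field^'n^'n"
  assumes "c \<noteq> 0"
  shows "det (pencil (cut I A) (block I C) c) = c ^ card I * det (pencil (cut I C) (block I A) (inverse c))"
proof -
  define d where "d i = (if i \<in> I then c else 1)" for i
  have "pencil (cut I A) (block I C) c = (\<chi> i. d i *s (pencil (cut I C) (block I A) (inverse c)) $ i)"
    using assms by (auto simp: vec_eq_iff d_def pencil_def cut_def block_def algebra_simps)
  then have "det (pencil (cut I A) (block I C) c) = prod d UNIV * det (\<chi> i. (pencil (cut I C) (block I A) (inverse c)) $ i)"
    by (simp only: det_rows_mul)
  then show ?thesis by (simp add: d_def prod.If_cases vec_lambda_eta)
qed

lemma order_x_unique:
  fixes r s :: "'a::idom poly"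
  assumes "[:0, 1:] ^ k * r = [:0, 1:] ^ m * s" "poly r 0 \<noteq> 0"
  shows "m \<le> k"
proof (rule ccontr)
  assume "\<not> m \<le> k"
  then obtain j where j: "m = k + Suc j" by (metis add_Suc_right less_imp_Suc_add not_le)
  have "[:0, 1:] ^ k * r = [:0, 1:] ^ k * ([:0, 1:] ^ Suc j * s)"
    using assms(1) unfolding j power_add by (simp only: mult.assoc)
  then have "r = [:0, 1:] ^ Suc j * s" by (subst (asm) mult_cancel_left) simp
  then show False using assms(2) by simp
qed

lemma nonvanishing_poly_const:
  fixes p :: "'a::alg_closed_field poly"
  assumes "\<And>c. poly p c \<noteq> 0"
  shows "p = [:poly p 0:]"
proof -
  have "degree p = 0" using alg_closed_imp_poly_has_root assms by blast
  then show ?thesis by (metis degree_0_id poly_0_coeff_0)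
qed

section \<open>Linear systems of quadrics without base points\<close>

locale quadric_system =
  fixes B :: "'a::{alg_closed_field,field_char_0}^'n \<Rightarrow> 'a^'n^'n"
  assumes linear: "B (v + c *s w) = pencil (B v) (B w) c"
    and symmetric: "transpose (B v) = B v"
    and base_point_free: "y \<noteq> 0 \<Longrightarrow> \<exists>v. qform (B v) y \<noteq> 0"
begin

lemma qform_linear: "qform (B (v + c *s w)) y = qform (B v) y + c * qform (B w) y"
  by (simp add: linear qform_def pencil_mult_vec algebra_simps sum.distrib sum_distrib_left)

text \<open>If every member were singular, a kernel vector of the member given by
  \<open>generic_kernel\<close> would be isotropic for the whole system, hence a base point.\<close>

lemma regular_member: "\<exists>v. det (B v) \<noteq> 0"
proof (rule ccontr)
  assume "\<not> ?thesis"
  then have sing: "\<And>v. det (B v) = 0" by blast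
  obtain X0 where X0: "X0 \<in> range B" "\<And>y Y. X0 *v y = 0 \<Longrightarrow> Y \<in> range B \<Longrightarrow> qform Y y = 0"
    by (rule generic_kernel[of "range B" "range B"]) (auto simp: symmetric simp flip: linear)
  then obtain y where "y \<noteq> 0" "X0 *v y = 0" using sing det_eq_0_iff_kernel by blast
  then show False using X0(2) base_point_free by blast
qed

text \<open>The argument of \<open>regular_member\<close> on the coordinate subspace of
  \<open>I\<close>: a kernel vector of a \<open>cut\<close> matrix is supported in \<open>I\<close>,
  where \<open>block\<close> and the full matrix give the same quadratic form.\<close>

lemma regular_restriction:
  assumes "invertible P"
  shows "\<exists>v. det (cut I (congruent_by P (B v))) \<noteq> 0"
proof (rule ccontr)
  assume "\<not> ?thesis"
  then have sing: "\<And>v. det (cut I (congruent_by P (B v))) = 0" by blast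
  let ?X = "range (\<lambda>v. cut I (congruent_by P (B v)))"
  let ?Y = "range (\<lambda>v. block I (congruent_by P (B v)))"
  obtain X0 where X0: "X0 \<in> ?X" "\<And>y Y. X0 *v y = 0 \<Longrightarrow> Y \<in> ?Y \<Longrightarrow> qform Y y = 0"
    by (rule generic_kernel[of ?X ?Y])
      (auto simp: symmetric transpose_cut transpose_congruent_by
        simp flip: linear cut_pencil congruent_by_pencil)
  then obtain v y where y: "y \<noteq> 0" "X0 *v y = 0" "X0 = cut I (congruent_by P (B v))"
    using sing det_eq_0_iff_kernel by blast
  then have supp: "\<And>i. i \<notin> I \<Longrightarrow> y $ i = 0"
    unfolding y(3) cut_mult_vec_eq_0 by metis
  have "qform (B w) (P *v y) = 0" for w
    using X0(2)[OF y(2), of "block I (congruent_by P (B w))"]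
    by (simp add: qform_block[OF supp] qform_congruent_by)
  then show False using base_point_free[of "P *v y"] y(1) assms by (simp add: invertible_mult_vec_eq_0)
qed

text \<open>
  \<open>B v\<close> restricted to \<open>ker (B z)\<close> is regular exactly when \<open>l v \<noteq> 0\<close>. For \<open>v0\<close> of maximal rank in
  \<open>ker l\<close>, the determinant of \<open>B p + c B v0\<close> on \<open>ker (B z)\<close> never vanishes, so it is constant in
  \<open>c\<close>, and the determinant of \<open>B v0 + c B p\<close> is a multiple of \<open>c\<^sup>m\<close> with \<open>m \<ge> 2\<close>.
\<close>

lemma no_multiple_tangent_cone:
  assumes l: "\<And>v w c. l (v + c *s w) = l v + c * l w" and lp: "l p \<noteq> 0" and m: "m \<ge> 2"
    and cone: "\<And>v. \<exists>r. det_pencil (B z) (B v) = [:0, 1:] ^ m * r \<and> (poly r 0 = 0 \<longleftrightarrow> l v = 0)"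
  shows False
proof -
  have "det (B z) = 0"
  proof -
    obtain r where "det_pencil (B z) (B p) = [:0, 1:] ^ m * r" using cone by blast
    then have "poly (det_pencil (B z) (B p)) 0 = 0" using m by simp
    then show ?thesis by (simp add: poly_det_pencil)
  qed
  then obtain y where y: "B z *v y = 0" "y \<noteq> 0" unfolding det_eq_0_iff_kernel by blast
  obtain P :: "'a^'n^'n" and i0 I where P: "invertible P" "i0 \<in> I" "P *v axis i0 1 = y"
    "coord_kernel (congruent_by P (B z)) I" "card I = vec.dim {u. B z *v u = 0}"
    by (rule adapted_congruence[OF y]) blast
  define B' where "B' v = congruent_by P (B v)" for v
  have sym': "transpose (B' v) = B' v" for v
    by (simp add: B'_def transpose_congruent_by symmetric)
  have lin': "B' (v + c *s w) = pencil (B' v) (B' w) c" for v c w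
    by (simp add: B'_def linear congruent_by_pencil)
  have d0: "[:det P ^ 2:] \<noteq> 0" using P(1) by (simp add: invertible_det_nz)
  have cone': "\<exists>r. det_pencil (B' z) (B' v) = [:0, 1:] ^ m * r \<and> (poly r 0 = 0 \<longleftrightarrow> l v = 0)" for v
  proof -
    obtain r where "det_pencil (B z) (B v) = [:0, 1:] ^ m * r" "poly r 0 = 0 \<longleftrightarrow> l v = 0"
      using cone by blast
    then have "det_pencil (B' z) (B' v) = [:0, 1:] ^ m * ([:det P ^ 2:] * r)"
      "poly ([:det P ^ 2:] * r) 0 = 0 \<longleftrightarrow> l v = 0"
      using d0 by (simp_all add: B'_def det_pencil_congruent_by)
    then show ?thesis by blast
  qed
  have restr: "\<exists>r. det_pencil (B' z) (B' v) = [:0, 1:] ^ card I * r \<and> (poly r 0 = 0 \<longleftrightarrow> det (cut I (B' v)) = 0)" for v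
    by (rule det_pencil_coord_kernel[OF sym' P(4)[folded B'_def], of "B' v"]) blast
  \<comment> \<open>Both numbers occur as exact orders at 0: \<open>card I\<close> for a
    \<open>v\<close> with regular restriction, \<open>m\<close> for \<open>p\<close>.\<close>
  have mk: "m = card I"
  proof (rule antisym)
    obtain v where "det (cut I (B' v)) \<noteq> 0" using regular_restriction[OF P(1)] unfolding B'_def by blast
    then show "m \<le> card I" using restr[of v] cone'[of v] order_x_unique by metis
    show "card I \<le> m" using restr[of p] cone'[of p] order_x_unique lp by metis
  qed
  have sing: "det (cut I (B' v)) = 0 \<longleftrightarrow> l v = 0" for v
  proof -
    obtain r s where r: "det_pencil (B' z) (B' v) = [:0, 1:] ^ m * r" "poly r 0 = 0 \<longleftrightarrow> l v = 0"
      and s: "det_pencil (B' z) (B' v) = [:0, 1:] ^ m * s" "poly s 0 = 0 \<longleftrightarrow> det (cut I (B' v)) = 0"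
      using cone'[of v] restr[of v] mk by blast
    have "r = s" using r(1) s(1) by simp
    then show ?thesis using r(2) s(2) by simp
  qed
  let ?X = "(\<lambda>v. cut I (B' v)) ` {v. l v = 0}"
  let ?Y = "(\<lambda>v. block I (B' v)) ` {v. l v = 0}"
  have l0: "l 0 = 0" using l[of 0 1 0] by simp
  obtain X0 where X0: "X0 \<in> ?X" "\<And>y Y. X0 *v y = 0 \<Longrightarrow> Y \<in> ?Y \<Longrightarrow> qform Y y = 0"
  proof (rule generic_kernel[of ?X ?Y])
    show "?X \<noteq> {}" using l0 by auto
    show "transpose X = X" if "X \<in> ?X" for X using that by (auto simp: sym' transpose_cut)
    show "pencil X Y c \<in> ?X" if "X \<in> ?X" "Y \<in> ?Y" for X Y c
      using that by (auto simp: l simp flip: cut_pencil lin' intro!: imageI)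
  qed blast
  then obtain v0 where v0: "l v0 = 0" "X0 = cut I (B' v0)" by blast
  \<comment> \<open>All \<open>p + c *s v0\<close> have the same nonzero value of \<open>l\<close>,
    so the restriction is regular for every \<open>c\<close>; a polynomial without roots over an
    algebraically closed field is constant.\<close>
  have "poly (det_pencil (cut I (B' p)) (block I (B' v0))) c \<noteq> 0" for c
    using sing[of "p + c *s v0"] lp by (simp add: poly_det_pencil l v0 lin' cut_pencil)
  from nonvanishing_poly_const[OF this]
  obtain d where d: "det (pencil (cut I (B' p)) (block I (B' v0)) c) = d" for c
    by (metis poly_det_pencil poly_pCons mult_zero_right add_0_right poly_0)
  have "det_pencil (cut I (B' v0)) (block I (B' p)) = [:0, 1:] ^ m * [:d:]"
  proof (rule poly_eqI_infinite)
    fix c :: 'a assume "c \<noteq> 0"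
    then show "poly (det_pencil (cut I (B' v0)) (block I (B' p))) c = poly ([:0, 1:] ^ m * [:d:]) c"
      by (simp add: poly_det_pencil det_cut_scale d mk)
  qed
  then have "[:0, 1:] ^ 2 dvd det_pencil (cut I (B' v0)) (block I (B' p))"
    using m le_imp_power_dvd dvd_mult2 by metis
  then obtain u where u: "u \<noteq> 0" "cut I (B' v0) *v u = 0" "qform (block I (B' p)) u = 0"
    using isotropic_kernel_vector[of "cut I (B' v0)"] sym' transpose_cut by metis
  then have supp: "\<And>i. i \<notin> I \<Longrightarrow> u $ i = 0"
    unfolding cut_mult_vec_eq_0 by metis
  have zero: "qform (B w) (P *v u) = 0" if "l w = 0" for w
    using X0(2)[of u "block I (B' w)"] that v0 u(2)
    by (simp add: qform_block[OF supp] qform_congruent_by B'_def)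
  have zerop: "qform (B p) (P *v u) = 0"
    using u(3) by (simp add: qform_block[OF supp] qform_congruent_by B'_def)
  \<comment> \<open>Every \<open>w\<close> is the sum of a vector in the kernel of \<open>l\<close>
    and a multiple of \<open>p\<close>, so \<open>P *v u\<close> is a base point.\<close>
  have "qform (B w) (P *v u) = 0" for w
  proof -
    have "l (w + (- (l w / l p)) *s p) = 0" using lp by (subst l) simp
    from zero[OF this] show ?thesis using zerop by (simp only: qform_linear mult_zero_right add_0_right)
  qed
  then show False using base_point_free[of "P *v u"] u(1) P(1) by (simp add: invertible_mult_vec_eq_0)
qed

end

section \<open>Evaluation, derivatives and restriction to lines\<close>

text \<open>One predicate covers evaluation, constants, substitution and specialisation, so that
  compatibility with powers, sums and determinants is proved once.\<close>

definition ring_map :: "('a::comm_ring_1 \<Rightarrow> 'b::comm_ring_1) \<Rightarrow> bool" where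
  "ring_map h \<longleftrightarrow> h 0 = 0 \<and> h 1 = 1 \<and> (\<forall>a b. h (a + b) = h a + h b) \<and> (\<forall>a b. h (a * b) = h a * h b)"

lemma ring_mapD:
  assumes "ring_map h"
  shows "h 0 = 0" "h 1 = 1" "h (a + b) = h a + h b" "h (a * b) = h a * h b"
  using assms by (auto simp: ring_map_def)

lemma ring_map_uminus: "ring_map h \<Longrightarrow> h (- a) = - h a"
  using ring_mapD(1,3)[of h] by (metis add.right_inverse add_eq_0_iff)

lemma ring_map_power: "ring_map h \<Longrightarrow> h (a ^ n) = h a ^ n"
  by (induction n) (auto simp: ring_mapD)

lemma ring_map_sum: "ring_map h \<Longrightarrow> h (sum f A) = (\<Sum>a\<in>A. h (f a))"
  by (induction A rule: infinite_finite_induct) (auto simp: ring_mapD)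

lemma ring_map_prod: "ring_map h \<Longrightarrow> h (prod f A) = (\<Prod>a\<in>A. h (f a))"
  by (induction A rule: infinite_finite_induct) (auto simp: ring_mapD)

lemma ring_map_of_nat: "ring_map h \<Longrightarrow> h (of_nat n) = of_nat n"
  by (induction n) (auto simp: ring_mapD)

lemma ring_map_of_int: "ring_map h \<Longrightarrow> h (of_int n) = of_int n"
  by (cases n) (auto simp: ring_mapD ring_map_of_nat ring_map_uminus simp del: of_nat_Suc)

lemma ring_map_det:
  assumes "ring_map h"
  shows "h (det A) = det (\<chi> i j. h (A $ i $ j))"
  unfolding det_def by (simp add: assms ring_map_sum ring_mapD(4) ring_map_prod ring_map_of_int)

lemma ring_map_dvd: "ring_map h \<Longrightarrow> a dvd b \<Longrightarrow> h a dvd h b"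
  by (auto elim!: dvdE simp: ring_mapD)

lemma ring_map_comp: "ring_map g \<Longrightarrow> ring_map h \<Longrightarrow> ring_map (\<lambda>x. g (h x))"
  by (simp add: ring_map_def)

lemma ring_map_id: "ring_map (\<lambda>x. x)"
  by (simp add: ring_map_def)

lemma ring_map_const_poly: "ring_map (\<lambda>c. [:c:])"
  by (simp add: ring_map_def)

lemma ring_map_poly: "ring_map (\<lambda>p. poly p c)"
  by (simp add: ring_map_def)

lemma poly_mapping_sum_single: "p = (\<Sum>m\<in>Poly_Mapping.keys p. Poly_Mapping.single m (Poly_Mapping.lookup p m))"
  by (rule poly_mapping_eqI) (auto simp: lookup_sum lookup_single when_def in_keys_iff)

lemma mpoly_induct [case_names zero single add]:
  fixes p :: "('n, 'a::comm_ring_1) mpoly"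
  assumes "P 0" "\<And>m c. P (Poly_Mapping.single m c)" "\<And>p q. P p \<Longrightarrow> P q \<Longrightarrow> P (p + q)"
  shows "P p"
proof -
  have "P (\<Sum>m\<in>A. Poly_Mapping.single m (Poly_Mapping.lookup p m))" if "finite A" for A
    using that by induction (auto intro: assms)
  then show ?thesis using poly_mapping_sum_single[of p] by (metis finite_keys)
qed

text \<open>Substitution with values in any commutative ring; evaluation at a point, restriction to
  a line and the generic shift are all instances.\<close>

definition insertion :: "('a::comm_ring_1 \<Rightarrow> 'b::comm_ring_1) \<Rightarrow> ('n::finite \<Rightarrow> 'b) \<Rightarrow> ('n, 'a) mpoly \<Rightarrow> 'b" where
  "insertion h a p = (\<Sum>m\<in>Poly_Mapping.keys p. h (Poly_Mapping.lookup p m) * (\<Prod>i\<in>UNIV. a i ^ Poly_Mapping.lookup m i))"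

lemma eval_eq_insertion: "eval p x = insertion (\<lambda>c. c) (\<lambda>i. x $ i) p"
  by (simp add: eval_def insertion_def)

lemma insertion_superset:
  assumes "ring_map h" "finite S" "Poly_Mapping.keys p \<subseteq> S"
  shows "insertion h a p = (\<Sum>m\<in>S. h (Poly_Mapping.lookup p m) * (\<Prod>i\<in>UNIV. a i ^ Poly_Mapping.lookup m i))"
  unfolding insertion_def using assms
  by (intro sum.mono_neutral_left) (auto simp: in_keys_iff ring_mapD)

lemma insertion_0 [simp]: "insertion h a 0 = 0"
  by (simp add: insertion_def)

lemma insertion_add:
  assumes "ring_map h"
  shows "insertion h a (p + q) = insertion h a p + insertion h a q"
proof -
  let ?S = "Poly_Mapping.keys p \<union> Poly_Mapping.keys q"
  have "insertion h a (p + q) = (\<Sum>m\<in>?S. h (Poly_Mapping.lookup (p + q) m) * (\<Prod>i\<in>UNIV. a i ^ Poly_Mapping.lookup m i))"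
    using assms by (intro insertion_superset) (auto simp: keys_add)
  also have "\<dots> = insertion h a p + insertion h a q"
    using assms by (simp add: insertion_superset[of h ?S] lookup_add ring_mapD distrib_right sum.distrib)
  finally show ?thesis .
qed

lemma insertion_single:
  assumes "ring_map h"
  shows "insertion h a (Poly_Mapping.single m c) = h c * (\<Prod>i\<in>UNIV. a i ^ Poly_Mapping.lookup m i)"
  by (subst insertion_superset[OF assms, of "{m}"]) auto

lemma insertion_mult:
  assumes "ring_map h"
  shows "insertion h a (p * q) = insertion h a p * insertion h a q"
proof (induction p rule: mpoly_induct)
  case (single m c)
  show ?case
  proof (induction q rule: mpoly_induct)
    case (single m' c')
    show ?case
      by (simp add: mult_single insertion_single assms ring_mapD lookup_add power_add prod.distrib mult_ac)
  qed (auto simp: distrib_left insertion_add assms)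
qed (auto simp: distrib_right insertion_add assms)

lemma insertion_1:
  assumes "ring_map h"
  shows "insertion h a 1 = 1"
  by (simp add: insertion_single assms ring_mapD flip: single_one)

lemma ring_map_insertion: "ring_map h \<Longrightarrow> ring_map (insertion h a)"
  unfolding ring_map_def[of "insertion h a"] by (simp add: insertion_add insertion_mult insertion_1)

lemma insertion_Var: "ring_map h \<Longrightarrow> insertion h a (Var i) = a i"
proof -
  assume h: "ring_map h"
  have "(\<Prod>j\<in>UNIV. a j ^ Poly_Mapping.lookup (Poly_Mapping.single i 1) j) = (\<Prod>j\<in>UNIV. if j = i then a j else 1)"
    by (rule prod.cong) (auto simp: lookup_single when_def)
  then show ?thesis
    by (simp add: Var_def insertion_single h ring_mapD)
qed

lemma ring_map_insertion_comp:
  assumes "ring_map g" "ring_map h"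
  shows "g (insertion h a p) = insertion (\<lambda>c. g (h c)) (\<lambda>i. g (a i)) p"
  by (simp add: insertion_def assms ring_map_sum ring_map_prod ring_map_power ring_mapD)

lemma ring_map_eval: "ring_map (\<lambda>p. eval p x)"
  unfolding eval_eq_insertion by (rule ring_map_insertion[OF ring_map_id])

lemmas eval_hom = ring_mapD[OF ring_map_eval]

section \<open>Formal partial derivatives and Euler's formula\<close>

lemma partial_superset:
  assumes "finite S" "Poly_Mapping.keys p \<subseteq> S"
  shows "partial i p = (\<Sum>m\<in>S. Poly_Mapping.single (m - Poly_Mapping.single i 1)
       (of_nat (Poly_Mapping.lookup m i) * Poly_Mapping.lookup p m))"
  unfolding partial_def using assms
  by (intro sum.mono_neutral_left) (auto simp: in_keys_iff)

lemma partial_0 [simp]: "partial i 0 = 0"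
  by (simp add: partial_def)

lemma partial_add: "partial i (p + q) = partial i p + partial i q"
proof -
  let ?S = "Poly_Mapping.keys p \<union> Poly_Mapping.keys q"
  have "partial i (p + q) = (\<Sum>m\<in>?S. Poly_Mapping.single (m - Poly_Mapping.single i 1)
       (of_nat (Poly_Mapping.lookup m i) * Poly_Mapping.lookup (p + q) m))"
    by (intro partial_superset) (auto simp: keys_add)
  also have "\<dots> = partial i p + partial i q"
    by (simp add: partial_superset[of ?S] lookup_add distrib_left single_add sum.distrib)
  finally show ?thesis .
qed

lemma partial_single:
  "partial i (Poly_Mapping.single m c) =
    Poly_Mapping.single (m - Poly_Mapping.single i 1) (of_nat (Poly_Mapping.lookup m i) * c)"
  by (subst partial_superset[of "{m}"]) auto

lemma partial_commute: "partial i (partial j p) = partial j (partial i p)"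
proof (cases "i = j")
  case False
  show ?thesis
  proof (induction p rule: mpoly_induct)
    case (single m c)
    have "m - Poly_Mapping.single j 1 - Poly_Mapping.single i 1 = m - Poly_Mapping.single i 1 - Poly_Mapping.single j (1::nat)"
      by (rule poly_mapping_eqI) (simp add: lookup_minus)
    then show ?case using False
      by (simp add: partial_single lookup_minus lookup_single mult_ac)
  qed (auto simp: partial_add)
qed simp

lemma eval_partial:
  "eval (partial i p) x = (\<Sum>m\<in>Poly_Mapping.keys p. Poly_Mapping.lookup p m * of_nat (Poly_Mapping.lookup m i) *
     (x $ i ^ (Poly_Mapping.lookup m i - 1) * (\<Prod>j\<in>UNIV - {i}. x $ j ^ Poly_Mapping.lookup m j)))"
proof -
  have *: "(\<Prod>j\<in>UNIV. x $ j ^ Poly_Mapping.lookup (m - Poly_Mapping.single i 1) j) =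
    x $ i ^ (Poly_Mapping.lookup m i - 1) * (\<Prod>j\<in>UNIV - {i}. x $ j ^ Poly_Mapping.lookup m j)" for m
    by (subst prod.remove[of _ i]) (auto simp: lookup_minus lookup_single when_def intro!: prod.cong)
  show ?thesis
    unfolding partial_def ring_map_sum[OF ring_map_eval]
    by (simp add: eval_eq_insertion insertion_single[OF ring_map_id] * mult_ac del: One_nat_def)
qed

lemma euler:
  assumes "homogeneous d p"
  shows "(\<Sum>i\<in>UNIV. x $ i * eval (partial i p) x) = of_nat d * eval p x"
proof -
  \<comment> \<open>At \<open>e = 0\<close> the subtraction in the exponent truncates, but the
    factor \<open>of_nat e\<close> makes both sides 0.\<close>
  have *: "x $ i * (C * of_nat e * (x $ i ^ (e - 1) * P)) = C * of_nat e * (x $ i ^ e * P)" for i e P C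
    by (cases e) (auto simp: mult_ac)
  have **: "(\<Prod>j\<in>UNIV. x $ j ^ Poly_Mapping.lookup m j) =
    x $ i ^ Poly_Mapping.lookup m i * (\<Prod>j\<in>UNIV - {i}. x $ j ^ Poly_Mapping.lookup m j)" for i m
    by (rule prod.remove) auto
  have key: "x $ i * (C * of_nat (Poly_Mapping.lookup m i) *
      (x $ i ^ (Poly_Mapping.lookup m i - 1) * (\<Prod>j\<in>UNIV - {i}. x $ j ^ Poly_Mapping.lookup m j))) =
    C * of_nat (Poly_Mapping.lookup m i) * (\<Prod>j\<in>UNIV. x $ j ^ Poly_Mapping.lookup m j)" for i m C
    unfolding **[of m i] by (rule *)
  have "(\<Sum>i\<in>UNIV. x $ i * eval (partial i p) x) =
    (\<Sum>i\<in>UNIV. \<Sum>m\<in>Poly_Mapping.keys p. Poly_Mapping.lookup p m * of_nat (Poly_Mapping.lookup m i) *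
      (\<Prod>j\<in>UNIV. x $ j ^ Poly_Mapping.lookup m j))"
    unfolding eval_partial sum_distrib_left
    by (intro sum.cong refl key)
  also have "\<dots> = (\<Sum>m\<in>Poly_Mapping.keys p. of_nat (mdegree m) * (Poly_Mapping.lookup p m *
      (\<Prod>j\<in>UNIV. x $ j ^ Poly_Mapping.lookup m j)))"
    by (subst sum.swap) (simp add: mdegree_def sum_distrib_right sum_distrib_left mult_ac)
  also have "\<dots> = of_nat d * eval p x"
    using assms by (simp add: eval_def homogeneous_def sum_distrib_left)
  finally show ?thesis .
qed

lemma homogeneous_partial:
  assumes "homogeneous (Suc d) p"
  shows "homogeneous d (partial i p)"
  unfolding homogeneous_def
proof
  fix k assume "k \<in> Poly_Mapping.keys (partial i p)"
  then obtain m where m: "m \<in> Poly_Mapping.keys p" "k \<in> Poly_Mapping.keys (Poly_Mapping.single (m - Poly_Mapping.single i 1)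
       (of_nat (Poly_Mapping.lookup m i) * Poly_Mapping.lookup p m))"
    unfolding partial_def using keys_sum by fastforce
  then have k: "k = m - Poly_Mapping.single i 1" and "Poly_Mapping.lookup m i \<noteq> 0"
    by (auto split: if_splits simp: keys_single intro!: Nat.gr0I)
  then have "Poly_Mapping.lookup m j = Poly_Mapping.lookup k j + (if j = i then 1 else 0)" for j
    by (auto simp: lookup_minus lookup_single when_def)
  then have "mdegree m = mdegree k + 1"
    by (simp add: mdegree_def sum.distrib)
  then show "mdegree k = d" using assms m(1) by (auto simp: homogeneous_def)
qed

lemma eval_homogeneous_0:
  assumes "homogeneous 0 p"
  shows "eval p x = eval p y"
  unfolding eval_def using assms
  by (intro sum.cong refl) (auto simp: homogeneous_def mdegree_def)

section \<open>Restriction to lines, and polynomials that vanish as functions\<close>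

definition on_line :: "'a::comm_ring_1 ^ 'n \<Rightarrow> 'a ^ 'n \<Rightarrow> ('n::finite, 'a) mpoly \<Rightarrow> 'a poly" where
  "on_line x v = insertion (\<lambda>c. [:c:]) (\<lambda>i. [:x $ i, v $ i:])"

lemma poly_on_line: "poly (on_line x v p) c = eval p (x + c *s v)"
proof -
  have "(\<lambda>i. x $ i + c * v $ i) = ($) (x + c *s v)" by auto
  then show ?thesis
    unfolding on_line_def eval_eq_insertion ring_map_insertion_comp[OF ring_map_poly ring_map_const_poly]
    by simp
qed

lemma pderiv_on_line:
  fixes x :: "'a::{idom,ring_char_0}^'n"
  shows "poly (pderiv (on_line x v p)) 0 = (\<Sum>i\<in>UNIV. v $ i * eval (partial i p) x)"
proof (induction p rule: mpoly_induct)
  case (single m c)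
  have *: "(\<Prod>j\<in>UNIV. x $ j ^ Poly_Mapping.lookup (m - Poly_Mapping.single i 1) j) =
    x $ i ^ (Poly_Mapping.lookup m i - 1) * (\<Prod>j\<in>UNIV - {i}. x $ j ^ Poly_Mapping.lookup m j)" for i
    by (subst prod.remove[of _ i]) (auto simp: lookup_minus lookup_single when_def intro!: prod.cong)
  show ?case
    unfolding on_line_def insertion_single[OF ring_map_const_poly] partial_single eval_eq_insertion
      insertion_single[OF ring_map_id] *
    by (simp add: pderiv_mult pderiv_smult pderiv_prod pderiv_power pderiv_pCons poly_sum poly_prod poly_mult
        sum_distrib_left mult_ac)
qed (auto simp: on_line_def insertion_add[OF ring_map_const_poly] partial_add pderiv_add eval_hom
      distrib_left sum.distrib)

lemma lookup_partial:
  "Poly_Mapping.lookup (partial i p) k =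
    of_nat (Suc (Poly_Mapping.lookup k i)) * Poly_Mapping.lookup p (k + Poly_Mapping.single i 1)"
proof (induction p rule: mpoly_induct)
  case (single m c)
  show ?case
  proof (cases "Poly_Mapping.lookup m i = 0")
    case True
    then have "m \<noteq> k + Poly_Mapping.single i 1"
      by (auto simp: lookup_add)
    then show ?thesis using True by (simp add: partial_single lookup_single)
  next
    case False
    then have "m - Poly_Mapping.single i 1 = k \<longleftrightarrow> m = k + Poly_Mapping.single i 1"
      by (auto simp: poly_mapping_eq_iff fun_eq_iff lookup_add lookup_minus lookup_single when_def)
    then show ?thesis
      by (auto simp: partial_single lookup_single when_def lookup_add)
  qed
qed (auto simp: partial_add lookup_add distrib_left)

text \<open>Induction on a degree bound: vanishing everywhere passes to the partial derivatives,
  which have smaller degree and are therefore 0. In characteristic 0 this leaves only the constant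
  coefficient, and evaluation at 0 removes it.\<close>

lemma eval_eq_0_imp_eq_0:
  fixes p :: "('n::finite, 'a::field_char_0) mpoly"
  assumes "\<And>x. eval p x = 0"
  shows "p = 0"
proof -
  have "p = 0" if "\<And>m. m \<in> Poly_Mapping.keys p \<Longrightarrow> mdegree m < N" "\<And>x. eval p x = 0"
    for p :: "('n, 'a) mpoly" and N
    using that
  proof (induction N arbitrary: p)
    case 0
    then show ?case by (metis keys_eq_empty ex_in_conv not_less_zero)
  next
    case (Suc N)
    have part: "partial i p = 0" for i
    proof (rule Suc.IH)
      fix m assume "m \<in> Poly_Mapping.keys (partial i p)"
      then have "m + Poly_Mapping.single i 1 \<in> Poly_Mapping.keys p"
        by (auto simp: in_keys_iff lookup_partial)
      moreover have "mdegree (m + Poly_Mapping.single i 1) = Suc (mdegree m)"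
        by (simp add: mdegree_def lookup_add sum.distrib lookup_single when_def)
      ultimately show "mdegree m < N" using Suc.prems(1) by fastforce
    next
      fix x
      have "on_line x (axis i 1) p = 0"
        by (rule poly_eqI_infinite) (simp add: poly_on_line Suc.prems(2))
      then have "0 = (\<Sum>j\<in>UNIV. axis i 1 $ j * eval (partial j p) x)"
        using pderiv_on_line[of x "axis i 1" p] by simp
      then show "eval (partial i p) x = 0"
        by (simp add: axis_def if_distrib if_distribR cong: if_cong)
    qed
    have "Poly_Mapping.lookup p m = 0" if "m \<noteq> 0" for m
    proof -
      obtain i where i: "Poly_Mapping.lookup m i \<noteq> 0"
        using \<open>m \<noteq> 0\<close> by (auto simp: poly_mapping_eq_iff fun_eq_iff)
      then have "m = (m - Poly_Mapping.single i 1) + Poly_Mapping.single i 1"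
        by (auto simp: poly_mapping_eq_iff fun_eq_iff lookup_add lookup_minus lookup_single when_def)
      then show ?thesis using lookup_partial[of i p "m - Poly_Mapping.single i 1"] part
        by (metis lookup_zero mult_eq_0_iff of_nat_eq_0_iff nat.distinct(1))
    qed
    then have p: "p = Poly_Mapping.single 0 (Poly_Mapping.lookup p 0)"
      by (intro poly_mapping_eqI) (auto simp: lookup_single when_def)
    have "eval p 0 = Poly_Mapping.lookup p 0"
      by (subst p) (simp add: eval_eq_insertion insertion_single[OF ring_map_id])
    then show ?case using Suc.prems(2) p by (metis single_zero)
  qed
  moreover have "\<exists>N. \<forall>m\<in>Poly_Mapping.keys p. mdegree m < N"
    by (metis finite_nat_set_iff_bounded finite_imageI finite_keys imageI)
  ultimately show ?thesis using assms by blast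
qed

section \<open>Fraction fields and the ring of polynomial functions\<close>

text \<open>The trivial Euclidean structure of a field. Together with the gcd instances that follow,
  it gives unique factorisation and Bezout identities for polynomials over
  \<open>'a fract\<close>.\<close>

instantiation fract :: (idom) "{unique_euclidean_ring, normalization_euclidean_semiring, normalization_semidom_multiplicative}"
begin

definition [simp]: "normalize_fract = (normalize_field :: 'a fract \<Rightarrow> _)"
definition [simp]: "unit_factor_fract = (unit_factor_field :: 'a fract \<Rightarrow> _)"
definition [simp]: "modulo_fract = (mod_field :: 'a fract \<Rightarrow> _)"
definition [simp]: "euclidean_size_fract = (euclidean_size_field :: 'a fract \<Rightarrow> _)"
definition [simp]: "division_segment (x :: 'a fract) = 1"

instance
  by standard
    (simp_all add: dvd_field_iff field_split_simps split: if_splits)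

end

instantiation fract :: (idom) euclidean_ring_gcd
begin

definition gcd_fract :: "'a fract \<Rightarrow> 'a fract \<Rightarrow> 'a fract" where
  "gcd_fract = Euclidean_Algorithm.gcd"
definition lcm_fract :: "'a fract \<Rightarrow> 'a fract \<Rightarrow> 'a fract" where
  "lcm_fract = Euclidean_Algorithm.lcm"
definition Gcd_fract :: "'a fract set \<Rightarrow> 'a fract" where
 "Gcd_fract = Euclidean_Algorithm.Gcd"
definition Lcm_fract :: "'a fract set \<Rightarrow> 'a fract" where
 "Lcm_fract = Euclidean_Algorithm.Lcm"

instance by standard (simp_all add: gcd_fract_def lcm_fract_def Gcd_fract_def Lcm_fract_def)

end

instance fract :: (idom) field_gcd ..

lemma of_nat_fract: "(of_nat n :: 'a::idom fract) = to_fract (of_nat n)"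
  by (induction n) auto

instance fract :: ("{idom,ring_char_0}") ring_char_0
  by standard (auto simp: inj_def of_nat_fract)

lemma eval_fun:
  "eval 0 = (\<lambda>x. 0)" "eval 1 = (\<lambda>x. 1)" "eval (p + q) = (\<lambda>x. eval p x + eval q x)"
  "eval (p * q) = (\<lambda>x. eval p x * eval q x)" "eval (- p) = (\<lambda>x. - eval p x)"
  by (auto simp: eval_hom ring_map_uminus[OF ring_map_eval])

text \<open>
  The polynomial ring of \<open>Defs\<close> is not available as an \<open>idom\<close>, because the library instance needs
  a linear order on the variables. Polynomial functions over an infinite field give an isomorphic ring.
\<close>

typedef (overloaded) ('n, 'a) polyfun = "range (eval :: ('n::finite, 'a::field_char_0) mpoly \<Rightarrow> 'a ^ 'n \<Rightarrow> 'a)"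
  by blast

setup_lifting type_definition_polyfun

instantiation polyfun :: (finite, field_char_0) comm_ring_1
begin

lift_definition zero_polyfun :: "('a, 'b) polyfun" is "\<lambda>x. 0"
  by (simp flip: eval_fun)
lift_definition one_polyfun :: "('a, 'b) polyfun" is "\<lambda>x. 1"
  by (simp flip: eval_fun)
lift_definition plus_polyfun :: "('a, 'b) polyfun \<Rightarrow> ('a, 'b) polyfun \<Rightarrow> ('a, 'b) polyfun"
  is "\<lambda>f g x. f x + g x"
  by (auto simp flip: eval_fun)
lift_definition times_polyfun :: "('a, 'b) polyfun \<Rightarrow> ('a, 'b) polyfun \<Rightarrow> ('a, 'b) polyfun"
  is "\<lambda>f g x. f x * g x"
  by (auto simp flip: eval_fun)
lift_definition uminus_polyfun :: "('a, 'b) polyfun \<Rightarrow> ('a, 'b) polyfun"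
  is "\<lambda>f x. - f x"
  by (auto simp flip: eval_fun)
definition minus_polyfun :: "('a, 'b) polyfun \<Rightarrow> ('a, 'b) polyfun \<Rightarrow> ('a, 'b) polyfun"
  where "minus_polyfun f g = f + - g"

instance
  by standard (unfold minus_polyfun_def, (transfer; simp add: fun_eq_iff algebra_simps)+)

end

lift_definition val :: "('n::finite, 'a::field_char_0) polyfun \<Rightarrow> 'a ^ 'n \<Rightarrow> 'a" is "\<lambda>f. f" .

lift_definition of_mpoly :: "('n::finite, 'a::field_char_0) mpoly \<Rightarrow> ('n, 'a) polyfun" is eval
  by blast

lemma val_of_mpoly: "val (of_mpoly p) x = eval p x"
  by transfer simp

lemma polyfun_eqI: "(\<And>x. val f x = val g x) \<Longrightarrow> f = g"
  by transfer auto

lemma of_mpoly_surj: "\<exists>p. f = of_mpoly p"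
  by transfer auto

lemma ring_map_val: "ring_map (\<lambda>f. val f x)"
  unfolding ring_map_def by (intro conjI allI; transfer; simp)

lemmas val_hom = ring_mapD[OF ring_map_val]

lemma ring_map_of_mpoly: "ring_map of_mpoly"
  unfolding ring_map_def
  by (auto intro!: polyfun_eqI simp: val_of_mpoly val_hom eval_hom)

lemma of_mpoly_eq_iff: "of_mpoly p = of_mpoly q \<longleftrightarrow> p = q"
proof
  assume *: "of_mpoly p = of_mpoly q"
  have "p + - q = 0"
  proof (rule eval_eq_0_imp_eq_0)
    fix x
    have "eval p x = eval q x" using * by (metis val_of_mpoly)
    then show "eval (p + - q) x = 0" by (simp only: eval_hom ring_map_uminus[OF ring_map_eval]) simp
  qed
  then show "p = q" by simp
qed simp

lemma of_mpoly_dvd_iff: "of_mpoly p dvd of_mpoly q \<longleftrightarrow> p dvd q"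
proof
  assume "of_mpoly p dvd of_mpoly q"
  then obtain r where "of_mpoly q = of_mpoly p * r" by (auto elim: dvdE)
  moreover obtain s where "r = of_mpoly s" using of_mpoly_surj by blast
  ultimately have "q = p * s"
    by (simp add: of_mpoly_eq_iff flip: ring_mapD(4)[OF ring_map_of_mpoly])
  then show "p dvd q" by simp
qed (rule ring_map_dvd[OF ring_map_of_mpoly])

text \<open>On the line joining a point where \<open>f\<close> is nonzero to one where
  \<open>g\<close> is nonzero, both become nonzero polynomials in one variable.\<close>

lemma polyfun_no_zero_divisors:
  fixes f g :: "('n::finite, 'a::field_char_0) polyfun"
  assumes "f \<noteq> 0" "g \<noteq> 0"
  shows "f * g \<noteq> 0"
proof
  assume *: "f * g = 0"
  obtain x where x: "val f x \<noteq> 0" using assms(1) by (metis polyfun_eqI val_hom(1))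
  obtain y where y: "val g y \<noteq> 0" using assms(2) by (metis polyfun_eqI val_hom(1))
  obtain p q where pq: "f = of_mpoly p" "g = of_mpoly q" using of_mpoly_surj by metis
  define v where "v = y - x"
  have "on_line x v p * on_line x v q = 0"
  proof (rule poly_eqI_infinite)
    fix c
    have "val (f * g) (x + c *s v) = 0" using * by (simp add: val_hom)
    then show "poly (on_line x v p * on_line x v q) c = poly 0 c"
      by (simp only: val_hom pq val_of_mpoly poly_mult poly_on_line poly_0)
  qed
  moreover have "poly (on_line x v p) 0 \<noteq> 0" using x by (simp add: poly_on_line pq val_of_mpoly)
  moreover have "poly (on_line x v q) 1 \<noteq> 0" using y by (simp add: poly_on_line pq val_of_mpoly v_def)
  ultimately show False by auto
qed

instance polyfun :: (finite, field_char_0) idom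
  by standard (rule polyfun_no_zero_divisors)

lemma val_of_nat: "val (of_nat n) x = of_nat n"
  by (rule ring_map_of_nat[OF ring_map_val])

instance polyfun :: (finite, field_char_0) ring_char_0
  by standard (metis injI of_nat_eq_iff val_of_nat)

lemma exists_val_nonzero: "f \<noteq> 0 \<Longrightarrow> \<exists>x. val f x \<noteq> 0"
  by (metis polyfun_eqI val_hom(1))

lemma ring_map_map_poly: "ring_map h \<Longrightarrow> ring_map (map_poly h)"
  unfolding ring_map_def[of "map_poly h"]
  by (auto intro!: poly_eqI simp: coeff_map_poly ring_mapD coeff_mult ring_map_sum map_poly_1)

section \<open>The generic shift along a fixed direction and its specialisations\<close>

definition spec :: "'a ^ 'n \<Rightarrow> ('n::finite, 'a::field_char_0) polyfun poly \<Rightarrow> 'a poly" where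
  "spec x = map_poly (\<lambda>f. val f x)"

lemma ring_map_spec: "ring_map (spec x)"
  unfolding spec_def by (rule ring_map_map_poly[OF ring_map_val])

lemmas spec_hom = ring_mapD[OF ring_map_spec]

lemma coeff_spec: "coeff (spec x P) k = val (coeff P k) x"
  by (simp add: spec_def coeff_map_poly val_hom)

definition const :: "'a::field_char_0 \<Rightarrow> ('n::finite, 'a) polyfun" where
  "const c = of_mpoly (Poly_Mapping.single 0 c)"

lemma val_const: "val (const c) x = c"
  by (simp add: const_def val_of_mpoly eval_eq_insertion insertion_single[OF ring_map_id])

lemma ring_map_const: "ring_map const"
  unfolding ring_map_def by (auto intro!: polyfun_eqI simp: val_const val_hom)

lemma spec_pCons: "spec x (pCons a P) = pCons (val a x) (spec x P)"
  by (rule poly_eqI) (simp add: coeff_spec coeff_pCons split: nat.split)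

lemma val_poly_const: "val (poly P (const t)) x = poly (spec x P) t"
  by (induction P) (simp_all add: spec_pCons spec_hom val_hom val_const)

text \<open>With \<open>x\<close> generic this is \<open>H(t) = h(x + t p)\<close>;
  \<open>spec\<close> fixes \<open>x\<close> and gives the restriction to a line, and
  \<open>t = 0\<close> returns \<open>h\<close>.\<close>

definition shift :: "'a::field_char_0 ^ 'n \<Rightarrow> ('n::finite, 'a) mpoly \<Rightarrow> ('n, 'a) polyfun poly" where
  "shift p = insertion (\<lambda>c. [:const c:]) (\<lambda>i. [:of_mpoly (Var i), const (p $ i):])"

lemma ring_map_shift: "ring_map (shift p)"
  unfolding shift_def
  by (rule ring_map_insertion[OF ring_map_comp[OF ring_map_const_poly ring_map_const]])

lemma spec_shift: "spec x (shift p h) = on_line x p h"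
proof -
  have "spec x [:const c:] = [:c:]" for c
    by (simp add: spec_pCons spec_hom val_const)
  moreover have "spec x [:of_mpoly (Var i), const (p $ i):] = [:x $ i, p $ i:]" for i
    by (simp add: spec_pCons spec_hom val_const val_of_mpoly eval_eq_insertion insertion_Var[OF ring_map_id])
  ultimately show ?thesis
    unfolding shift_def on_line_def
    by (subst ring_map_insertion_comp[OF ring_map_spec ring_map_comp[OF ring_map_const_poly ring_map_const]]) simp
qed

lemma poly_shift_0: "poly (shift p h) 0 = of_mpoly h"
proof (rule polyfun_eqI)
  fix x
  have "val (poly (shift p h) (const 0)) x = eval h x"
    by (simp add: val_poly_const spec_shift poly_on_line)
  then show "val (poly (shift p h) 0) x = val (of_mpoly h) x"
    by (simp add: ring_mapD(1)[OF ring_map_const] val_of_mpoly)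
qed

lemma clear_denominators:
  fixes q :: "'r::idom fract poly"
  obtains a Q where "a \<noteq> 0" "smult (to_fract a) q = fract_poly Q"
proof -
  have "\<exists>a Q. a \<noteq> 0 \<and> smult (to_fract a) q = fract_poly Q"
  proof (induction q)
    case 0
    show ?case by (intro exI[of _ 1] exI[of _ 0]) simp
  next
    case (pCons c q)
    then obtain a Q where aQ: "a \<noteq> 0" "smult (to_fract a) q = fract_poly Q" by blast
    obtain n d where c: "c = Fract n d" "d \<noteq> 0" by (cases c)
    have "smult (to_fract (a * d)) (pCons c q) = pCons (to_fract (a * n)) (smult (to_fract d) (smult (to_fract a) q))"
      using c by (simp add: mult_ac to_fract_def eq_fract)
    also have "\<dots> = fract_poly (pCons (a * n) (smult d Q))"
      by (simp add: aQ(2) map_poly_pCons fract_poly_smult)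
    finally show ?case using aQ(1) c(2) by (metis mult_eq_0_iff)
  qed
  with that show thesis by blast
qed

lemma pderiv_fract_poly: "pderiv (fract_poly p) = fract_poly (pderiv p)"
  by (rule poly_eqI) (simp add: coeff_pderiv coeff_map_poly of_nat_fract to_fract_add to_fract_mult)

section \<open>The Hessian of a smooth cubic\<close>

lemma x_dvd_iff: "[:0, 1:] dvd p \<longleftrightarrow> poly p 0 = 0" for p :: "'a::idom poly"
  using poly_eq_0_iff_dvd[of p 0] by simp

lemma x_square_dvd_iff:
  fixes p :: "'a::idom poly"
  shows "[:0, 1:] ^ 2 dvd p \<longleftrightarrow> poly p 0 = 0 \<and> poly (pderiv p) 0 = 0"
proof
  assume "[:0, 1:] ^ 2 dvd p"
  then obtain q where "p = [:0, 1:] * ([:0, 1:] * q)"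
    by (auto elim!: dvdE simp: power2_eq_square mult.assoc)
  then show "poly p 0 = 0 \<and> poly (pderiv p) 0 = 0"
    by (simp add: pderiv_mult del: mult_pCons_left)
next
  assume *: "poly p 0 = 0 \<and> poly (pderiv p) 0 = 0"
  then obtain q where q: "p = [:0, 1:] * q" using x_dvd_iff by (blast elim: dvdE)
  have "poly (pderiv p) 0 = poly q 0"
    unfolding q by (simp add: pderiv_mult pderiv_pCons del: mult_pCons_left)
  then have "[:0, 1:] dvd q" using * x_dvd_iff by metis
  then show "[:0, 1:] ^ 2 dvd p" unfolding q power2_eq_square by (rule mult_dvd_mono[OF dvd_refl])
qed

text \<open>In adapted coordinates each dimension of the kernel contributes one factor of the
  variable; the constant \<open>det P ^ 2\<close> is a unit and can be removed.\<close>

lemma det_pencil_kernel_ge_2: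
  fixes A B :: "'a::field_char_0^'n^'n"
  assumes "transpose A = A" "vec.dim {u. A *v u = 0} \<ge> 2"
  shows "[:0, 1:] ^ 2 dvd det_pencil A B"
proof -
  have "\<not> {u. A *v u = 0} \<subseteq> {0}"
    using assms(2) vec.dim_eq_0[of "{u. A *v u = 0}"] by linarith
  then obtain y where y: "A *v y = 0" "y \<noteq> 0" by blast
  obtain P :: "'a^'n^'n" and i0 I where P: "invertible P" "i0 \<in> I" "P *v axis i0 1 = y"
    "coord_kernel (congruent_by P A) I" "card I = vec.dim {u. A *v u = 0}"
    by (rule adapted_congruence[OF y]) blast
  obtain r where r: "det_pencil (congruent_by P A) (congruent_by P B) = [:0, 1:] ^ card I * r"
    by (rule det_pencil_coord_kernel[OF _ P(4)]) (auto simp: transpose_congruent_by assms(1))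
  have "[:0, 1:] ^ 2 dvd [:det P ^ 2:] * det_pencil A B"
    unfolding det_pencil_congruent_by[symmetric] r
    using assms(2) P(5) by (intro dvd_mult2 le_imp_power_dvd) simp
  then have "[:0, 1:] ^ 2 dvd [:inverse (det P ^ 2):] * ([:det P ^ 2:] * det_pencil A B)"
    by (rule dvd_mult)
  also have "[:inverse (det P ^ 2):] * ([:det P ^ 2:] * det_pencil A B) = det_pencil A B"
    using P(1) by (simp add: invertible_det_nz)
  finally show ?thesis .
qed

text \<open>The rank is taken from the rows, and symmetry turns rows into columns, which span the
  image. The coordinates outside \<open>I\<close> parametrise the image bijectively, so rank and
  kernel dimension are the sizes of complementary sets.\<close>

lemma rank_symmetric_singular:
  fixes A :: "'a::field^'n^'n"
  assumes "transpose A = A" "A *v y = 0" "y \<noteq> 0"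
  shows "rank A + vec.dim {u. A *v u = 0} = CARD('n)"
proof -
  obtain P :: "'a^'n^'n" and i0 I where P: "invertible P" "i0 \<in> I" "P *v axis i0 1 = y"
    "\<And>u. A *v (P *v u) = 0 \<longleftrightarrow> (\<forall>i. i \<notin> I \<longrightarrow> u $ i = 0)"
    "card I = vec.dim {u. A *v u = 0}"
    by (rule adapted_basis[OF assms(2,3)]) blast
  define W where "W = {x::'a^'n. \<forall>i. i \<notin> - I \<longrightarrow> x $ i = 0}"
  have subW: "vec.subspace W"
    unfolding vec.subspace_def W_def by auto
  have "rows A = columns A"
    by (subst assms(1)[symmetric]) (auto simp: rows_def columns_def row_def column_def transpose_def)
  have "vec.span (columns A) = range ((*v) A)"
  proof
    show "range ((*v) A) \<subseteq> vec.span (columns A)"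
      using matrix_vector_mult_in_columnspace_gen by blast
    have "columns A \<subseteq> range ((*v) A)"
    proof
      fix c assume "c \<in> columns A"
      then obtain i where "c = column i A" by (auto simp: columns_def)
      then have "c = A *v axis i 1"
        by (simp add: vec_eq_iff column_def matrix_vector_mult_def axis_def if_distrib cong: if_cong)
      then show "c \<in> range ((*v) A)" by blast
    qed
    then show "vec.span (columns A) \<subseteq> range ((*v) A)"
      by (rule vec.span_minimal) (rule vec.subspace_image[OF vec.subspace_UNIV])
  qed
  also have "range ((*v) A) = (*v) (A ** P) ` W"
  proof
    show "range ((*v) A) \<subseteq> (*v) (A ** P) ` W"
    proof safe
      fix x
      obtain u where u: "x = P *v u"
        using P(1) by (metis invertible_right_inverse matrix_vector_mul_assoc matrix_vector_mul_lid)
      define w where "w = (\<chi> i. if i \<in> I then 0 else u $ i)"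
      have "A *v (P *v (u - w)) = 0" unfolding P(4) by (simp add: w_def)
      then have "A *v x = (A ** P) *v w"
        by (simp add: u matrix_vector_mult_diff_distrib matrix_vector_mul_assoc)
      moreover have "w \<in> W" by (simp add: W_def w_def)
      ultimately show "A *v x \<in> (*v) (A ** P) ` W" by blast
    qed
  qed (auto simp flip: matrix_vector_mul_assoc)
  finally have "vec.dim (rows A) = vec.dim ((*v) (A ** P) ` W)"
    using \<open>rows A = columns A\<close> vec.dim_span by metis
  also have "\<dots> = vec.dim W"
  proof (rule vec.dim_image_eq)
    show "Vector_Spaces.linear (*s) (*s) ((*v) (A ** P))" by simp
    have "vec.span W = W" using subW by (rule vec.span_eq_iff[THEN iffD2])
    moreover have "inj_on ((*v) (A ** P)) W"
    proof (rule inj_onI)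
      fix u w assume uw: "u \<in> W" "w \<in> W" "(A ** P) *v u = (A ** P) *v w"
      then have "A *v (P *v (u - w)) = 0"
        by (simp add: matrix_vector_mult_diff_distrib matrix_vector_mul_assoc)
      then show "u = w" unfolding P(4) using uw(1,2) by (simp add: W_def vec_eq_iff) metis
    qed
    ultimately show "inj_on ((*v) (A ** P)) (vec.span W)" by (simp only:)
  qed
  also have "\<dots> = card (- I)" unfolding W_def by (rule dim_substandard_cart)
  finally have "rank A = card (- I)" by (simp add: row_rank_def_gen)
  moreover have "card I \<le> CARD('n)" by (rule card_mono) auto
  ultimately show ?thesis using P(5) by (simp add: Compl_eq_Diff_UNIV card_Diff_subset)
qed

text \<open>The second derivatives of a cubic are linear forms, so Euler's formula in degree 1
  applies; the third derivatives are constant and are simply read off at 0.\<close>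

lemma hessian_entry:
  assumes "homogeneous 3 f"
  shows "hessian_at f x $ i $ j = (\<Sum>k\<in>UNIV. x $ k * eval (partial k (partial i (partial j f))) 0)"
proof -
  have "homogeneous (Suc 0) (partial i (partial j f))"
    using assms by (intro homogeneous_partial) (simp add: numeral_3_eq_3)
  from euler[OF this, of x] eval_homogeneous_0[OF homogeneous_partial[OF this], of _ x 0]
  show ?thesis by (simp add: hessian_at_def hessian_matrix_def)
qed

lemma hessian_at_linear:
  assumes "homogeneous 3 f"
  shows "hessian_at f (v + c *s w) = pencil (hessian_at f v) (hessian_at f w) c"
  by (simp add: vec_eq_iff pencil_def hessian_entry[OF assms] distrib_right sum.distrib
      sum_distrib_left mult.assoc)

lemma hessian_at_symmetric: "transpose (hessian_at f x) = hessian_at f x"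
  by (simp add: vec_eq_iff transpose_def hessian_at_def hessian_matrix_def partial_commute)

text \<open>The third derivatives form a symmetric tensor, so \<open>v\<close> can change places
  with one \<open>y\<close>; Euler's formula for the quadratic first derivatives supplies the factor
  2.\<close>

lemma qform_hessian_at:
  assumes "homogeneous 3 f"
  shows "qform (hessian_at f v) y = 2 * (\<Sum>k\<in>UNIV. v $ k * eval (partial k f) y)"
proof -
  define t where "t k i j = eval (partial k (partial i (partial j f))) 0" for k i j
  have t: "t k i j = t j i k" for i j k
    unfolding t_def by (metis partial_commute)
  have H: "hessian_at f x $ i $ j = (\<Sum>k\<in>UNIV. x $ k * t k i j)" for x i j
    unfolding t_def by (rule hessian_entry[OF assms])
  have "2 * eval (partial k f) y = (\<Sum>i\<in>UNIV. y $ i * hessian_at f y $ i $ k)" for k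
    using euler[of 2 "partial k f" y] homogeneous_partial[of 2 f k] assms
    by (simp add: hessian_at_def hessian_matrix_def numeral_3_eq_3 numeral_2_eq_2)
  then have "2 * (\<Sum>k\<in>UNIV. v $ k * eval (partial k f) y) =
      (\<Sum>k\<in>UNIV. v $ k * (\<Sum>i\<in>UNIV. y $ i * hessian_at f y $ i $ k))"
    by (simp add: sum_distrib_left mult.left_commute[of 2])
  also have "\<dots> = (\<Sum>k\<in>UNIV. \<Sum>i\<in>UNIV. \<Sum>j\<in>UNIV. v $ k * y $ i * y $ j * t j i k)"
    by (simp add: H sum_distrib_left mult_ac)
  also have "\<dots> = (\<Sum>i\<in>UNIV. \<Sum>k\<in>UNIV. \<Sum>j\<in>UNIV. v $ k * y $ i * y $ j * t k i j)"
    by (subst sum.swap) (simp add: t)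
  also have "\<dots> = (\<Sum>i\<in>UNIV. \<Sum>j\<in>UNIV. \<Sum>k\<in>UNIV. v $ k * y $ i * y $ j * t k i j)"
    by (intro sum.cong refl sum.swap)
  also have "\<dots> = qform (hessian_at f v) y"
    by (simp add: qform_def matrix_vector_mult_def H sum_distrib_left sum_distrib_right mult_ac)
  finally show ?thesis by simp
qed

text \<open>A vector isotropic for all Hessians annihilates the gradient of \<open>f\<close>, and by
  Euler's formula also \<open>f\<close>, so it would be a singular point of the cubic.\<close>

lemma ex_qform_hessian_nonzero:
  fixes f :: "('n::finite, 'a::field_char_0) mpoly"
  assumes hom: "homogeneous 3 f" and sm: "smooth_hypersurface f" and "y \<noteq> 0"
  shows "\<exists>v. qform (hessian_at f v) y \<noteq> 0"
proof (rule ccontr)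
  assume "\<not> ?thesis"
  then have q: "qform (hessian_at f v) y = 0" for v by blast
  have part: "eval (partial k f) y = 0" for k
    using q[of "axis k 1"] unfolding qform_hessian_at[OF hom]
    by (simp add: axis_def if_distrib if_distribR cong: if_cong)
  have "3 * eval f y = 0" using euler[OF hom, of y] by (simp add: part)
  then have "proj_point y \<in> sing_locus f"
    using part \<open>y \<noteq> 0\<close> by (auto simp: sing_locus_def)
  then show False using sm by (simp add: smooth_hypersurface_def)
qed

lemma quadric_system_hessian:
  fixes f :: "('n::finite, 'a::{alg_closed_field,field_char_0}) mpoly"
  assumes "homogeneous 3 f" "smooth_hypersurface f"
  shows "quadric_system (hessian_at f)"
  by standard (use assms in \<open>auto simp: hessian_at_linear hessian_at_symmetric ex_qform_hessian_nonzero\<close>)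

lemma eval_hessian_poly: "eval (hessian_poly f) x = det (hessian_at f x)"
  unfolding hessian_poly_def ring_map_det[OF ring_map_eval] hessian_at_def ..

text \<open>The Hessian matrix is linear in the point. Through this identity, orders of vanishing of
  the Hessian polynomial along lines become statements about pencils.\<close>

lemma on_line_hessian_poly:
  fixes f :: "('n::finite, 'a::field_char_0) mpoly"
  assumes "homogeneous 3 f"
  shows "on_line x v (hessian_poly f) = det_pencil (hessian_at f x) (hessian_at f v)"
  by (rule poly_eqI_infinite)
    (simp add: poly_on_line eval_hessian_poly poly_det_pencil hessian_at_linear assms)

lemma qform_scale: "qform A (c *s y) = c ^ 2 * qform A y" for A :: "'a::field^'n^'n"
  by (simp add: qform_def vec.scale sum_distrib_left power2_eq_square mult_ac)

text \<open>A point is singular exactly when the Hessian polynomial vanishes doubly in every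
  direction. Corank at least 2 forces this; in corank 1 the double zeros would make the kernel
  vector isotropic for every Hessian, against smoothness.\<close>

lemma hessian_singular_iff:
  fixes f :: "('n::finite, 'a::{alg_closed_field,field_char_0}) mpoly"
  assumes hom: "homogeneous 3 f" and sm: "smooth_hypersurface f" and n: "CARD('n) = n + 1" "n \<ge> 1"
  shows "eval (hessian_poly f) x = 0 \<and> (\<forall>i. eval (partial i (hessian_poly f)) x = 0) \<longleftrightarrow>
    rank (hessian_at f x) \<le> n - 1" (is "?S \<longleftrightarrow> _")
proof -
  let ?A = "hessian_at f x" and ?h = "hessian_poly f"
  have dvd: "?S \<longleftrightarrow> (\<forall>v. [:0, 1:] ^ 2 dvd det_pencil ?A (hessian_at f v))"
  proof -
    have "(\<forall>i. eval (partial i ?h) x = 0) \<longleftrightarrow> (\<forall>v. (\<Sum>i\<in>UNIV. v $ i * eval (partial i ?h) x) = 0)"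
      (is "_ \<longleftrightarrow> ?R")
    proof
      assume R: ?R
      show "\<forall>i. eval (partial i ?h) x = 0"
      proof
        fix i
        show "eval (partial i ?h) x = 0"
          using R[rule_format, of "axis i 1"] by (simp add: axis_def if_distrib if_distribR cong: if_cong)
      qed
    qed simp
    then show ?thesis
      unfolding x_square_dvd_iff on_line_hessian_poly[OF hom, symmetric] pderiv_on_line
      by (auto simp: poly_on_line)
  qed
  show ?thesis
  proof (cases "det ?A = 0")
    case False
    have "\<exists>B. B ** ?A = mat 1"
      using False by (simp add: invertible_det_nz flip: invertible_left_inverse)
    then have "vec.span (rows ?A) = UNIV" by (simp add: matrix_left_invertible_span_rows_gen)
    then have "rank ?A = CARD('n)"
      unfolding row_rank_def_gen by (metis vec.dim_span vec_dim_card)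
    then show ?thesis using False n by (simp add: eval_hessian_poly)
  next
    case True
    then obtain y where y: "?A *v y = 0" "y \<noteq> 0" unfolding det_eq_0_iff_kernel by blast
    let ?V = "{u. ?A *v u = 0}"
    \<comment> \<open>The matrices have size \<open>n + 1\<close>, so rank at most
      \<open>n - 1\<close> is corank at least 2.\<close>
    have "rank ?A \<le> n - 1 \<longleftrightarrow> vec.dim ?V \<ge> 2"
      using rank_symmetric_singular[OF hessian_at_symmetric y] n by linarith
    also have "\<dots> \<longleftrightarrow> (\<forall>v. [:0, 1:] ^ 2 dvd det_pencil ?A (hessian_at f v))"
    proof
      assume "vec.dim ?V \<ge> 2"
      then show "\<forall>v. [:0, 1:] ^ 2 dvd det_pencil ?A (hessian_at f v)"
        using det_pencil_kernel_ge_2 hessian_at_symmetric by blast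
    next
      assume *: "\<forall>v. [:0, 1:] ^ 2 dvd det_pencil ?A (hessian_at f v)"
      show "vec.dim ?V \<ge> 2"
      proof (rule ccontr)
        assume "\<not> vec.dim ?V \<ge> 2"
        then have "?V \<subseteq> vec.span {y}"
          using y by (intro vec.card_ge_dim_independent) auto
        \<comment> \<open>The isotropic vector \<open>y'\<close> depends on \<open>v\<close>, but in
          a one-dimensional kernel it is always a multiple of \<open>y\<close>.\<close>
        have "qform (hessian_at f v) y = 0" for v
        proof -
          obtain y' where y': "y' \<noteq> 0" "?A *v y' = 0" "qform (hessian_at f v) y' = 0"
            using isotropic_kernel_vector[OF hessian_at_symmetric *[rule_format]] by blast
          then obtain c where "y' = c *s y"
            using \<open>?V \<subseteq> vec.span {y}\<close> by (auto simp: vec.span_singleton)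
          then show ?thesis using y' by (simp add: qform_scale)
        qed
        then show False using ex_qform_hessian_nonzero[OF hom sm y(2)] by blast
      qed
    qed
    finally show ?thesis using dvd by simp
  qed
qed

section \<open>Squarefreeness of the shifted Hessian polynomial and descent from the fraction
  field\<close>

lemma coeff_prod_linear:
  fixes a b :: "'i \<Rightarrow> 'a::idom"
  assumes "finite S"
  shows "degree (\<Prod>i\<in>S. [:a i, b i:]) \<le> card S \<and> coeff (\<Prod>i\<in>S. [:a i, b i:]) (card S) = (\<Prod>i\<in>S. b i)"
  using assms
proof induction
  case (insert i S)
  let ?P = "\<Prod>i\<in>S. [:a i, b i:]"
  have "degree ([:a i, b i:] * ?P) \<le> degree [:a i, b i:] + degree ?P" by (rule degree_mult_le)
  moreover have "coeff ?P (Suc (card S)) = 0"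
    using insert by (intro coeff_eq_0) simp
  ultimately show ?case using insert by (simp split: if_splits)
qed simp

text \<open>Applied with \<open>B\<close> a regular Hessian at \<open>p\<close>: the top coefficient
  is then a nonzero constant whatever \<open>A\<close> is, which makes the leading coefficient of
  the shift a unit.\<close>

lemma degree_det_pencil:
  fixes A B :: "'a::idom^'n^'n"
  shows "degree (det_pencil A B) \<le> CARD('n)" and "coeff (det_pencil A B) (CARD('n)) = det B"
proof -
  have *: "of_int k * q = smult (of_int k) q" for k and q :: "'a poly"
    by (simp add: of_int_poly)
  have eq: "det_pencil A B = (\<Sum>p | p permutes UNIV. smult (of_int (sign p)) (\<Prod>i\<in>UNIV. [:A $ i $ p i, B $ i $ p i:]))"
    by (simp add: det_pencil_def det_def *)
  show "degree (det_pencil A B) \<le> CARD('n)"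
    unfolding eq
    by (intro degree_sum_le) (auto intro!: order.trans[OF degree_smult_le] simp: coeff_prod_linear[THEN conjunct1])
  show "coeff (det_pencil A B) (CARD('n)) = det B"
    unfolding eq det_def by (simp add: coeff_sum coeff_prod_linear[THEN conjunct2])
qed

lemma x_power_dvd_cancel:
  fixes a b :: "'a::idom poly"
  assumes "[:0, 1:] ^ m dvd a * b" "poly a 0 \<noteq> 0"
  shows "[:0, 1:] ^ m dvd b"
  using assms(1)
proof (induction m arbitrary: b)
  case (Suc m)
  have "[:0, 1:] dvd a * b" using Suc.prems by (meson dvd_power dvd_trans zero_less_Suc)
  then have "poly b 0 = 0" using assms(2) by (simp add: x_dvd_iff)
  then obtain b' where b': "b = [:0, 1:] * b'" using x_dvd_iff by (blast elim: dvdE)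
  have "[:0, 1:] * [:0, 1:] ^ m dvd [:0, 1:] * (a * b')"
    using Suc.prems unfolding b' power_Suc by (simp only: mult.left_commute)
  then have "[:0, 1:] ^ m dvd a * b'" by (subst (asm) dvd_mult_cancel_left) simp
  then have "[:0, 1:] ^ m dvd b'" by (rule Suc.IH)
  then show ?case unfolding b' power_Suc by (rule mult_dvd_mono[OF dvd_refl])
qed simp

lemma fract_poly_power: "fract_poly (p ^ n) = fract_poly p ^ n"
  by (induction n) simp_all

lemma to_fract_power: "to_fract (a ^ n) = to_fract a ^ n"
  by (induction n) simp_all

text \<open>A repeated prime factor \<open>q\<close>, taken with its exact multiplicity
  \<open>m\<close>, is coprime to the cofactor and, in characteristic 0, to its own derivative. A
  Bezout identity cleared of denominators shows that at a generic \<open>x0\<close> every root of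
  \<open>Q\<close> is simple and not a root of \<open>U\<close>.\<close>

lemma exists_multiple_point:
  fixes H :: "('n::finite, 'a::{alg_closed_field,field_char_0}) polyfun poly"
  assumes H0: "H \<noteq> 0" and nsq: "\<not> squarefree (fract_poly H)"
  obtains m D Q U x0 t where "m \<ge> 2" "smult D H = Q ^ m * U" "val D x0 \<noteq> 0"
    "poly (spec x0 Q) t = 0" "poly (pderiv (spec x0 Q)) t \<noteq> 0" "poly (spec x0 U) t \<noteq> 0"
proof -
  let ?H = "fract_poly H"
  have H: "?H \<noteq> 0" using H0 by simp
  obtain q where q: "prime q" "q ^ 2 dvd ?H"
    using nsq H squarefree_factorial_semiring'[of ?H] squarefree_factorial_semiring[of ?H] by auto
  define m where "m = multiplicity q ?H"
  have "\<not> is_unit q" using q(1) by auto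
  then have m: "m \<ge> 2" unfolding m_def using q(2) H by (intro multiplicity_geI) auto
  obtain u where u: "?H = q ^ m * u" "\<not> q dvd u"
    unfolding m_def by (rule multiplicity_decompose'[OF H \<open>\<not> is_unit q\<close>])
  have deg: "degree q > 0"
    using q(1) \<open>\<not> is_unit q\<close> by (metis is_unit_iff_degree gr0I not_prime_0)
  have "pderiv q \<noteq> 0" using deg by (simp add: pderiv_eq_0_iff)
  moreover have "degree (pderiv q) < degree q" using deg by (simp add: degree_pderiv)
  ultimately have "\<not> q dvd pderiv q" using dvd_imp_degree_le not_le by blast
  then have "coprime q (u * pderiv q)"
    using u(2) q(1) by (metis prime_dvd_mult_iff prime_imp_coprime)
  then obtain r s where rs: "r * q + s * (u * pderiv q) = 1"
    by (metis bezout_coefficients_fst_snd coprime_imp_gcd_eq_1)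
  obtain a Q where a: "a \<noteq> 0" "smult (to_fract a) q = fract_poly Q" by (rule clear_denominators)
  obtain b U where b: "b \<noteq> 0" "smult (to_fract b) u = fract_poly U" by (rule clear_denominators)
  obtain c R where c: "c \<noteq> 0" "smult (to_fract c) r = fract_poly R" by (rule clear_denominators)
  obtain d S where d: "d \<noteq> 0" "smult (to_fract d) s = fract_poly S" by (rule clear_denominators)
  define D where "D = a ^ m * b"
  have "fract_poly (smult D H) = smult (to_fract a ^ m * to_fract b) (q ^ m * u)"
    by (simp add: D_def fract_poly_smult u(1) to_fract_power)
  also have "\<dots> = (smult (to_fract a) q) ^ m * smult (to_fract b) u"
    by (simp add: smult_power mult_ac)
  also have "\<dots> = fract_poly (Q ^ m * U)"
    by (simp add: a(2) b(2) fract_poly_mult fract_poly_power)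
  finally have DH: "smult D H = Q ^ m * U" by (simp only: fract_poly_eq_iff)
  \<comment> \<open>A common multiple of the denominators of the two Bezout terms,
    \<open>c a\<close> for the first and \<open>d a b\<close> for the second.\<close>
  define E where "E = c * d * a * a * b"
  have "fract_poly [:E:] = smult (to_fract E) (r * q + s * (u * pderiv q))"
    by (simp add: rs map_poly_pCons)
  also have "\<dots> = smult (to_fract (d * a * b)) ((smult (to_fract c) r) * (smult (to_fract a) q)) +
     smult (to_fract (c * a)) (smult (to_fract d) s * (smult (to_fract b) u * pderiv (smult (to_fract a) q)))"
    by (simp add: E_def pderiv_smult smult_add_right mult_ac)
  also have "\<dots> = fract_poly (smult (d * a * b) (R * Q) + smult (c * a) (S * (U * pderiv Q)))"
    unfolding a(2) b(2) c(2) d(2) pderiv_fract_poly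
    by (simp only: fract_poly_smult fract_poly_mult fract_poly_add)
  finally have E: "[:E:] = smult (d * a * b) (R * Q) + smult (c * a) (S * (U * pderiv Q))"
    by (simp only: fract_poly_eq_iff)
  have degQ: "degree Q = degree q"
    using a by (metis degree_map_poly degree_smult_eq to_fract_eq_0_iff)
  have "Q \<noteq> 0" using deg degQ by auto
  \<comment> \<open>Where this product is nonzero, \<open>Q\<close> keeps its positive degree, so a
    root \<open>t\<close> exists, and the left side \<open>E\<close> of the Bezout identity
    survives.\<close>
  then have "D * E * lead_coeff Q \<noteq> 0"
    using a(1) b(1) c(1) d(1) by (simp add: D_def E_def)
  then obtain x0 where "val (D * E * lead_coeff Q) x0 \<noteq> 0" using exists_val_nonzero by blast
  then have x0: "val D x0 \<noteq> 0" "val E x0 \<noteq> 0" "coeff (spec x0 Q) (degree Q) \<noteq> 0"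
    by (auto simp: val_hom coeff_spec)
  have "degree (spec x0 Q) > 0" using x0(3) deg degQ le_degree by (metis gr_zeroI le_zero_eq)
  then obtain t where t: "poly (spec x0 Q) t = 0" using alg_closed_imp_poly_has_root by blast
  have pd: "spec x0 (pderiv Q) = pderiv (spec x0 Q)"
    by (rule poly_eqI) (simp add: coeff_spec coeff_pderiv val_hom val_of_nat)
  have "spec x0 [:E:] = spec x0 ([:d * a * b:] * (R * Q) + [:c * a:] * (S * (U * pderiv Q)))"
    using E by simp
  then have "poly (spec x0 [:E:]) t =
    poly (spec x0 [:c * a:] * (spec x0 S * (spec x0 U * pderiv (spec x0 Q)))) t"
    unfolding spec_hom by (simp add: t pd)
  then have "poly (spec x0 U) t * poly (pderiv (spec x0 Q)) t \<noteq> 0"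
    using x0(2) by (auto simp: spec_pCons spec_hom)
  with m DH x0(1) t that show thesis by auto
qed

lemma spec_smult: "spec x (smult D H) = smult (val D x) (spec x H)"
  by (rule poly_eqI) (simp add: coeff_spec val_hom)

text \<open>At fixed \<open>t\<close> a repeated factor becomes a polynomial \<open>g\<close> in
  \<open>x\<close> such that \<open>h(x + t p)\<close> is \<open>g^m u\<close> up to factors nonzero
  at \<open>x0\<close>. Lowest-order terms at \<open>z = x0 + t p\<close> show that the tangent cone
  is a multiple of the \<open>m\<close>-th power of the differential \<open>l\<close> of
  \<open>g\<close>, which \<open>no_multiple_tangent_cone\<close> excludes.\<close>

lemma shift_hessian_squarefree:
  fixes f :: "('n::finite, 'a::{alg_closed_field,field_char_0}) mpoly"
  assumes hom: "homogeneous 3 f" and sm: "smooth_hypersurface f"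
    and nz: "shift p (hessian_poly f) \<noteq> 0"
  shows "squarefree (fract_poly (shift p (hessian_poly f)))"
proof (rule ccontr)
  let ?h = "hessian_poly f" and ?B = "hessian_at f"
  interpret quadric_system ?B by (rule quadric_system_hessian[OF hom sm])
  assume "\<not> ?thesis"
  then obtain m D Q U x0 t where m: "m \<ge> 2" and DH: "smult D (shift p ?h) = Q ^ m * U"
    and D0: "val D x0 \<noteq> 0" and Q0: "poly (spec x0 Q) t = 0"
    and Q1: "poly (pderiv (spec x0 Q)) t \<noteq> 0" and U0: "poly (spec x0 U) t \<noteq> 0"
    using exists_multiple_point[OF nz] by metis
  have spec: "smult (val D x) (on_line x p ?h) = spec x Q ^ m * spec x U" for x
    using arg_cong[OF DH, of "spec x"]
    by (simp add: spec_smult spec_shift spec_hom ring_map_power[OF ring_map_spec])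
  define z where "z = x0 + t *s p"
  obtain g where g: "poly Q (const t) = of_mpoly g" using of_mpoly_surj by blast
  obtain u where u: "poly U (const t) = of_mpoly u" using of_mpoly_surj by blast
  obtain D' where D': "D = of_mpoly D'" using of_mpoly_surj by blast
  have spec_gu: "poly (spec x Q) t = eval g x" "poly (spec x U) t = eval u x" for x
    by (simp_all add: g u val_of_mpoly flip: val_poly_const)
  have ev: "eval D' x * eval ?h (x + t *s p) = eval g x ^ m * eval u x" for x
    using arg_cong[OF spec, of "\<lambda>q. poly q t" x]
    by (simp add: poly_on_line D' val_of_mpoly spec_gu)
  have g0: "eval g x0 = 0" using Q0 by (simp add: spec_gu)
  have u0: "eval u x0 \<noteq> 0" using U0 by (simp add: spec_gu)
  have D'0: "eval D' x0 \<noteq> 0" using D0 by (simp add: D' val_of_mpoly)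
  define l where "l v = (\<Sum>i\<in>UNIV. v $ i * eval (partial i g) x0)" for v
  have cone: "\<exists>r. det_pencil (?B z) (?B v) = [:0, 1:] ^ m * r \<and>
    eval D' x0 * poly r 0 = l v ^ m * eval u x0" for v
  proof -
    \<comment> \<open>Moving \<open>z\<close> in direction \<open>v\<close> is moving
      \<open>x0\<close> in direction \<open>v\<close> with \<open>t\<close> fixed, so
      \<open>ev\<close> applies along the whole line.\<close>
    have eq: "on_line x0 v D' * on_line z v ?h = on_line x0 v g ^ m * on_line x0 v u"
    proof (rule poly_eqI_infinite)
      fix c
      have zc: "z + c *s v = (x0 + c *s v) + t *s p" by (simp add: z_def algebra_simps)
      then show "poly (on_line x0 v D' * on_line z v ?h) c = poly (on_line x0 v g ^ m * on_line x0 v u) c"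
        by (simp only: poly_mult poly_power poly_on_line zc ev)
    qed
    have "poly (on_line x0 v g) 0 = 0" using g0 by (simp add: poly_on_line)
    then obtain g1 where g1: "on_line x0 v g = [:0, 1:] * g1" using x_dvd_iff by (blast elim: dvdE)
    have "poly g1 0 = l v"
      using pderiv_on_line[of x0 v g] unfolding g1 l_def
      by (simp add: pderiv_mult pderiv_pCons del: mult_pCons_left)
    have "[:0, 1:] ^ m dvd on_line x0 v D' * on_line z v ?h"
      unfolding eq g1 power_mult_distrib mult.assoc by simp
    then obtain r where r: "on_line z v ?h = [:0, 1:] ^ m * r"
      using x_power_dvd_cancel[of m "on_line x0 v D'"] D'0
      by (metis dvdE poly_on_line vec.scale_zero_left add.right_neutral)
    have "[:0, 1:] ^ m * (on_line x0 v D' * r) = [:0, 1:] ^ m * (g1 ^ m * on_line x0 v u)"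
      using eq unfolding r g1 power_mult_distrib by (simp only: mult_ac)
    then have "on_line x0 v D' * r = g1 ^ m * on_line x0 v u" by simp
    from arg_cong[OF this, of "\<lambda>q. poly q 0"]
    have "eval D' x0 * poly r 0 = l v ^ m * eval u x0"
      using \<open>poly g1 0 = l v\<close> by (simp add: poly_on_line)
    with r on_line_hessian_poly[OF hom] show ?thesis by metis
  qed
  have cone': "\<exists>r. det_pencil (?B z) (?B v) = [:0, 1:] ^ m * r \<and> (poly r 0 = 0 \<longleftrightarrow> l v = 0)" for v
    using cone[of v] D'0 u0 m by (metis mult_eq_0_iff power_eq_0_iff not_numeral_le_zero neq0_conv)
  \<comment> \<open>In direction \<open>p\<close> the line can also be swept out by varying
    \<open>t\<close>. As \<open>t\<close> is a simple root of \<open>Q\<close> and no root of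
    \<open>U\<close>, the order at \<open>z\<close> is exactly \<open>m\<close>, whereas
    \<open>l p = 0\<close> would make it larger.\<close>
  have "l p \<noteq> 0"
  proof
    assume "l p = 0"
    then obtain r where r: "det_pencil (?B z) (?B p) = [:0, 1:] ^ m * r" "poly r 0 = 0"
      using cone' by blast
    define Qt where "Qt = pcompose (spec x0 Q) [:t, 1:]"
    define Ut where "Ut = pcompose (spec x0 U) [:t, 1:]"
    have "poly Qt 0 = 0" using Q0 by (simp add: Qt_def poly_pcompose)
    then obtain Q2 where Q2: "Qt = [:0, 1:] * Q2" using x_dvd_iff by (blast elim: dvdE)
    have "poly (pderiv Qt) 0 = poly Q2 0"
      unfolding Q2 by (simp add: pderiv_mult pderiv_pCons del: mult_pCons_left)
    moreover have "poly (pderiv Qt) 0 = poly (pderiv (spec x0 Q)) t"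
      by (simp add: Qt_def pderiv_pcompose poly_pcompose pderiv_pCons)
    ultimately have Q20: "poly Q2 0 \<noteq> 0" using Q1 by simp
    have "smult (val D x0) (on_line z p ?h) = Qt ^ m * Ut"
    proof (rule poly_eqI_infinite)
      fix c
      have zc: "x0 + (t + c) *s p = z + c *s p" by (simp add: z_def vec.scale_left_distrib)
      then show "poly (smult (val D x0) (on_line z p ?h)) c = poly (Qt ^ m * Ut) c"
        using arg_cong[OF spec[of x0], of "\<lambda>q. poly q (t + c)"]
        unfolding poly_smult poly_mult poly_power poly_on_line zc
        by (simp add: Qt_def Ut_def poly_pcompose)
    qed
    then have "[:0, 1:] ^ m * smult (val D x0) r = [:0, 1:] ^ m * (Q2 ^ m * Ut)"
      unfolding Q2 on_line_hessian_poly[OF hom] r(1) power_mult_distrib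
      by (simp only: mult_smult_left mult_smult_right mult_ac)
    then have "smult (val D x0) r = Q2 ^ m * Ut" by (subst (asm) mult_cancel_left) simp
    from arg_cong[OF this, of "\<lambda>q. poly q 0"]
    show False using r(2) Q20 U0 by (simp add: Ut_def poly_pcompose)
  qed
  then show False
    by (intro no_multiple_tangent_cone[of l p m z, OF _ _ m cone'])
      (simp_all add: l_def distrib_right sum.distrib sum_distrib_left mult.assoc)
qed

text \<open>Each prime of \<open>a\<close> occurs only once in \<open>a\<close> and at least once in
  \<open>b\<close>.\<close>

lemma squarefree_dvd_power_imp_dvd:
  fixes a b :: "'a::factorial_semiring_multiplicative"
  assumes "squarefree a" "a dvd b ^ n"
  shows "a dvd b"
proof (cases "b = 0")
  case False
  have "a \<noteq> 0" using assms(1) by auto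
  show ?thesis
  proof (rule multiplicity_le_imp_dvd[OF \<open>a \<noteq> 0\<close>])
    fix p :: 'a assume p: "prime p"
    show "multiplicity p a \<le> multiplicity p b"
    proof (cases "p dvd a")
      case True
      then have "p dvd b" using assms(2) p by (meson dvd_trans prime_dvd_power)
      then have "multiplicity p b \<ge> 1"
        using p False by (intro multiplicity_geI) auto
      moreover have "multiplicity p a \<le> 1"
        using assms(1) p \<open>a \<noteq> 0\<close> unfolding squarefree_factorial_semiring''[OF \<open>a \<noteq> 0\<close>] by auto
      ultimately show ?thesis by simp
    qed (simp add: not_dvd_imp_multiplicity_0)
  qed
qed simp

text \<open>A nonzero multiple of the remainder of pseudo-division is a multiple of \<open>H\<close>
  of smaller degree, hence 0. Powers of a unit are units, so the scaling of \<open>G\<close> by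
  \<open>e\<close> can be undone.\<close>

lemma fract_poly_dvd_unit_lead_coeff:
  fixes H G :: "'r::idom poly"
  assumes dvd: "fract_poly H dvd fract_poly G" and unit: "lead_coeff H dvd 1"
  shows "H dvd G"
proof -
  have H0: "H \<noteq> 0" using unit by auto
  obtain q r where qr: "pseudo_divmod G H = (q, r)" by fastforce
  define e where "e = lead_coeff H ^ (Suc (degree G) - degree H)"
  have e: "smult e G = H * q + r" and r: "r = 0 \<or> degree r < degree H"
    using pseudo_divmod[OF H0 qr] by (simp_all add: e_def)
  obtain W where W: "fract_poly G = fract_poly H * W" using dvd by (blast elim: dvdE)
  obtain a V where a: "a \<noteq> 0" "smult (to_fract a) W = fract_poly V" by (rule clear_denominators)
  have "fract_poly (smult a G) = fract_poly (H * V)"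
    by (simp add: fract_poly_smult fract_poly_mult W flip: a(2))
  then have aG: "smult a G = H * V" by (simp only: fract_poly_eq_iff)
  have "smult a r = smult a (smult e G) - smult a (H * q)"
    by (simp add: e smult_add_right)
  also have "\<dots> = smult e (smult a G) - smult a (H * q)" by (simp add: mult.commute)
  also have "\<dots> = H * (smult e V - smult a q)" by (simp add: aG right_diff_distrib)
  finally have ar: "smult a r = H * (smult e V - smult a q)" .
  have "r = 0"
  proof (rule ccontr)
    assume "r \<noteq> 0"
    then have "smult e V - smult a q \<noteq> 0" using ar a(1) by auto
    then have "degree (smult a r) \<ge> degree H" unfolding ar using H0 by (simp add: degree_mult_eq)
    then show False using r \<open>r \<noteq> 0\<close> a(1) by simp
  qed
  obtain c where "1 = lead_coeff H * c" using unit by (blast elim: dvdE)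
  then have "1 = e * c ^ (Suc (degree G) - degree H)" by (metis e_def power_mult_distrib power_one)
  then obtain e' where "1 = e * e'" by blast
  then have "G = smult e' (smult e G)" by (simp add: mult.commute)
  also have "\<dots> = H * smult e' q" using e \<open>r = 0\<close> by simp
  finally show ?thesis by (rule dvdI)
qed

theorem theoremA:
  fixes f :: "('n::finite, 'a::{alg_closed_field, field_char_0}) mpoly" and n :: nat
  assumes "CARD('n) = n + 1" and "n \<ge> 2"
    and "f \<noteq> 0" and "homogeneous 3 f" and "smooth_hypersurface f"
  shows "hessian_poly f \<noteq> 0 \<and> reduced_hypersurface (hessian_poly f)
    \<and> sing_locus (hessian_poly f) = degeneracy_locus (n - 1) f"
proof (intro conjI)
  let ?h = "hessian_poly f"
  note hom = assms(4) and sm = assms(5)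
  interpret quadric_system "hessian_at f" by (rule quadric_system_hessian[OF hom sm])
  obtain p where p: "det (hessian_at f p) \<noteq> 0" using regular_member by blast
  show "?h \<noteq> 0" using p by (metis eval_hessian_poly eval_hom(1))
  show "sing_locus ?h = degeneracy_locus (n - 1) f"
    unfolding sing_locus_def degeneracy_locus_def
    using hessian_singular_iff[OF hom sm assms(1)] assms(2) by auto
  have coeff: "val (coeff (shift p ?h) k) x = coeff (det_pencil (hessian_at f x) (hessian_at f p)) k" for k x
    by (simp add: spec_shift on_line_hessian_poly[OF hom] flip: coeff_spec)
  \<comment> \<open>This coefficient does not depend on \<open>x\<close>, so it is a constant
    function; the choice of \<open>p\<close> makes it a unit.\<close>
  have top: "coeff (shift p ?h) (CARD('n)) = const (det (hessian_at f p))"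
    by (rule polyfun_eqI) (simp add: coeff degree_det_pencil val_const)
  have c0: "const (det (hessian_at f p)) * const (inverse (det (hessian_at f p))) = (1 :: ('n, 'a) polyfun)"
    using p by (simp add: ring_mapD(2) ring_map_const flip: ring_mapD(4)[OF ring_map_const])
  have "degree (shift p ?h) \<le> CARD('n)"
  proof (rule degree_le, intro allI impI)
    fix k assume "k > CARD('n)"
    then show "coeff (shift p ?h) k = 0"
      using degree_det_pencil(1)[of _ "hessian_at f p"]
      by (intro polyfun_eqI) (auto simp: coeff val_hom intro!: coeff_eq_0 intro: le_less_trans)
  qed
  moreover have nz: "coeff (shift p ?h) (CARD('n)) \<noteq> 0" using c0 by (auto simp: top)
  ultimately have "degree (shift p ?h) = CARD('n)" using le_degree by (metis le_antisym)
  then have unit: "lead_coeff (shift p ?h) dvd 1"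
    using c0 by (simp add: top) (metis dvdI)
  have sf: "squarefree (fract_poly (shift p ?h))"
    using nz by (intro shift_hessian_squarefree[OF hom sm]) auto
  show "reduced_hypersurface ?h"
    unfolding reduced_hypersurface_def chart_zero_def
  proof (intro allI impI, elim conjE exE)
    fix i d g m N assume "?h dvd Var i ^ N * g ^ m"
    \<comment> \<open>The extra factor completes both exponents to \<open>N + m\<close>, giving
      divisibility of a power of \<open>Var i * g\<close>.\<close>
    then have "?h dvd Var i ^ N * g ^ m * (Var i ^ m * g ^ N)" by (rule dvd_mult2)
    then have "?h dvd (Var i * g) ^ (N + m)"
      by (simp add: power_add power_mult_distrib mult_ac)
    from ring_map_dvd[OF ring_map_shift this, of p]
    have "shift p ?h dvd shift p (Var i * g) ^ (N + m)"
      by (simp add: ring_map_power ring_map_shift)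
    then have "fract_poly (shift p ?h) dvd fract_poly (shift p (Var i * g)) ^ (N + m)"
      by (auto elim!: dvdE simp: fract_poly_mult simp flip: fract_poly_power)
    then have "fract_poly (shift p ?h) dvd fract_poly (shift p (Var i * g))"
      by (rule squarefree_dvd_power_imp_dvd[OF sf])
    then have "shift p ?h dvd shift p (Var i * g)"
      using unit by (rule fract_poly_dvd_unit_lead_coeff)
    \<comment> \<open>Setting \<open>t = 0\<close> undoes the shift; the witness for
      \<open>chart_zero\<close> is the exponent 1.\<close>
    from ring_map_dvd[OF ring_map_poly this, of 0]
    have "?h dvd Var i * g" by (simp only: poly_shift_0 of_mpoly_dvd_iff)
    then show "\<exists>N. ?h dvd Var i ^ N * g" by (metis power_one_right)
  qed
qed

end
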